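(* Let $\{z^{(k)}\}$ be the iterate sequence generated by PALM-I (described in the context, with $M_l=\gamma L$, $\gamma>1$, $M_u=M\ge M_l$). Suppose that: (1) for each $i=1,\ldots,n$ there is $L_i>0$ such that $\|\nabla_i f(z_1)-\nabla_i f(z_2)\|\le L_i\|z_1-z_2\|$ for all $z_1,z_2\in\prod_{j=1}^n\bar{\mathcal S}_j$; (2) for each $i=1,\ldots,n$, $\mathcal S_i$ is convex and compact, $h_i$ is linear or satisfies the Slater constraint qualification (there is $\hat x_i\in\mathbb R^{m_i}$ with $h_i(\hat x_i)<0$), and there is a constant $\tilde c_i\ge 0$ such that $\mathrm{dist}(x_i,\mathcal S_i)\le \tilde c_i\|\max\{h_i(x_i),0\}\|$ for all $x_i\in\tilde{\mathcal S}_i$; (3) $F$ has the Łojasiewicz property at each of its stationary points; (4) $\{\varepsilon^{(k)}\}$ is nonnegative and summable, and there exists $\bar\theta\in(0,1)$ such that $\{(e^{(k)})^{\bar\theta}\}$ is summable, where $e^{(k)}:=\sum_{t=k}^\infty(\varepsilon^{(t)})^2$ for $k\ge 0$. Then the sequence $\{z^{(k)}\}$ converges to a stationary point of $F$.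
   Context: Problem. $n,m_i,p_i$ are positive integers; $f:\prod_{i=1}^n\mathbb R^{m_i}\to\mathbb R$ is differentiable (not necessarily convex); for $i=1,\ldots,n$, $h_i=(h_{i,1},\ldots,h_{i,p_i})^\top:\mathbb R^{m_i}\to\mathbb R^{p_i}$ is convex and differentiable, and $\mathcal S_i:=\{w\in\mathbb R^{m_i}: h_i(w)\le 0\}$. Write $z=(x_1,\ldots,x_n)$ with $x_i\in\mathbb R^{m_i}$, and $F(z):=f(z)+\sum_{i=1}^n\delta_{\mathcal S_i}(x_i)$, where $\delta_{\mathcal S}$ is the indicator function ($0$ on $\mathcal S$, $+\infty$ off $\mathcal S$). $\nabla_i f$ is the gradient of $f$ with respect to $x_i$; $\nabla h_i(x_i)\in\mathbb R^{m_i\times p_i}$ has as columns the gradients of the components of $h_i$; $\|\cdot\|$ is the Euclidean norm; inequalities and $\max\{\cdot,0\}$ of vectors are componentwise; $\mathrm{dist}(w,\mathcal S)=\inf_{w'\in\mathcal S}\|w-w'\|$. $x_{<i}=(x_1,\ldots,x_{i-1})$, and similarly $x_{\ge i}$, etc. Residual. $r_i(x_i,\lambda_i,\tilde x_i):=\max\{\langle x_i,x_i-\tilde x_i+\nabla h_i(x_i)\lambda_i\rangle,0\}+\|x_i-\tilde x_i+\nabla h_i(x_i)\lambda_i\|_\infty+\|\max\{h_i(x_i),0\}\|_\infty+\max\{-\langle\lambda_i,h_i(x_i)\rangle,0\}$. PALM-I. Inputs: $z^{(0)}\in\prod_i\mathbb R^{m_i}$, $\bar\varepsilon>0$, a nonnegative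 sequence $\{\varepsilon^{(k)}\}$ with $\varepsilon^{(k)}\le\bar\varepsilon$, $M_u\ge M_l>0$, and $\sigma_i^{(0)}\in[M_l,M_u]$. For $k=0,1,2,\ldots$ and, successively, $i=1,\ldots,n$: put $\tilde x_i^{(k)}:=x_i^{(k)}-\frac{1}{\sigma_i^{(k)}}\nabla_i f(x_{<i}^{(k+1)},x_{\ge i}^{(k)})$; choose $x_i^{(k+1)}\in\mathbb R^{m_i}$ (not necessarily in $\mathcal S_i$) for which there is $\lambda_i^{(k+1)}\in\mathbb R_+^{p_i}$ with $\sqrt{r_i(x_i^{(k+1)},\lambda_i^{(k+1)},\tilde x_i^{(k)})}\le\varepsilon^{(k)}$; choose $\sigma_i^{(k+1)}\in[M_l,M_u]$. This generates $z^{(k)}=(x_1^{(k)},\ldots,x_n^{(k)})$. ($x_i^{(k+1)}$ is an inexact solution of $\min_{x_i\in\mathcal S_i}\langle\nabla_i f(x_{<i}^{(k+1)},x_{\ge i}^{(k)}),x_i-x_i^{(k)}\rangle+\frac{\sigma_i^{(k)}}{2}\|x_i-x_i^{(k)}\|^2$.) Further notation. $\bar{\mathcal S}_i:=\{w\in\mathbb R^{m_i}:\mathrm{dist}(w,\mathcal S_i)\le\bar\varepsilon\}$; $\bar{\mathcal M}_i:=\sup_{z\in\prod_j\bar{\mathcal S}_j}\|\nabla_i f(z)\|$; $\tilde{\mathcal S}_i:=\{w\in\mathbb R^{m_i}:\mathrm{dist}(w,\bar{\mathcal S}_i)\le\bar{\mathcal M}_i/M_l\}$. $L:=\max_i L_i$;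 the algorithm is run with $M_l=\gamma L$ for some $\gamma>1$ and $M_u=M$ any scalar with $M\ge M_l$. Subdifferential and Łojasiewicz property. For a proper closed $G:\mathbb E\to(-\infty,\infty]$ on a Euclidean space and $x\in\mathrm{dom}(G)$, $\partial G(x):=\{u\in\mathbb E:\liminf_{y\ne x,y\to x}\frac{G(y)-G(x)-\langle u,y-x\rangle}{\|y-x\|}\ge 0\}$ (Fréchet subdifferential), and $\partial G(x)=\emptyset$ otherwise. $x$ is a stationary point of $G$ if $0\in\partial G(x)$. $G$ has the Łojasiewicz property at a stationary point $\bar x$ if there are $c>0$, $\theta\in[0,1)$, $\eta>0$ such that $|G(x)-G(\bar x)|^\theta\le c\cdot\mathrm{dist}(0,\partial G(x))$ for all $x$ in the closed ball of radius $\eta$ around $\bar x$, with the convention $0^0=0$ if $\theta=0$ (so $|G(x)-G(\bar x)|^0=0$ means $G(x)=G(\bar x)$); $\theta$ is the Łojasiewicz exponent of $G$ at $\bar x$. *)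

theory Defs
  imports "HOL-Analysis.Analysis"
begin

text \<open>
  The product of the spaces \<open>R^{m_i}\<close>, \<open>i = 1..n\<close>, of arbitrary (possibly different) dimensions is
  \<open>real^'d\<close>, where \<open>'d\<close> is the disjoint union of the coordinate index sets of the blocks and
  \<open>blk :: 'd \<Rightarrow> nat\<close> sends a coordinate to its block, so that \<open>m_i = card {d. blk d = i}\<close>. The factor
  \<open>R^{m_i}\<close> is the coordinate subspace \<open>bspace blk i\<close>; Euclidean norm, inner product and
  \<open>infnorm\<close> of \<open>real^'d\<close> restrict to the ones of \<open>R^{m_i}\<close>. The constraint map \<open>h_i\<close> is given by its
  components \<open>h i j\<close>, \<open>j = 1..p i\<close>, of which only the values on \<open>bspace blk i\<close> are ever used; a
  vector of \<open>R^{p_i}\<close> is a function on \<open>{1..p i}\<close>.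
\<close>

definition bspace :: "('d::finite \<Rightarrow> nat) \<Rightarrow> nat \<Rightarrow> (real^'d) set" where
  "bspace blk i = {w. \<forall>d. blk d \<noteq> i \<longrightarrow> w $ d = 0}"

definition bproj :: "('d::finite \<Rightarrow> nat) \<Rightarrow> nat \<Rightarrow> real^'d \<Rightarrow> real^'d" where
  "bproj blk i z = (\<chi> d. if blk d = i then z $ d else 0)"

definition bupd :: "('d::finite \<Rightarrow> nat) \<Rightarrow> nat \<Rightarrow> real^'d \<Rightarrow> real^'d \<Rightarrow> real^'d" where
  "bupd blk i z w = (\<chi> d. if blk d = i then w $ d else z $ d)"

definition bprod :: "('d::finite \<Rightarrow> nat) \<Rightarrow> nat \<Rightarrow> (nat \<Rightarrow> (real^'d) set) \<Rightarrow> (real^'d) set" where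
  "bprod blk n A = {z. \<forall>i\<in>{1..n}. bproj blk i z \<in> A i}"

text \<open>Gradient at \<open>x\<close> of a function on the Euclidean space \<open>V\<close>, a subspace of the ambient space;
  requiring the gradient to lie in \<open>V\<close> makes it unique.\<close>

definition grad_on :: "'a::euclidean_space set \<Rightarrow> ('a \<Rightarrow> real) \<Rightarrow> 'a \<Rightarrow> 'a" where
  "grad_on V g x = (THE u. u \<in> V \<and> (g has_derivative (\<lambda>v. u \<bullet> v)) (at x within V))"

lemma grad_on_eqI:
  assumes V: "subspace V" and x: "x \<in> V" and u: "u \<in> V"
    and d: "(g has_derivative (\<lambda>v. u \<bullet> v)) (at x within V)"
  shows "grad_on V g x = u"
  unfolding grad_on_def
proof (rule the_equality)
  show "u \<in> V \<and> (g has_derivative (\<lambda>v. u \<bullet> v)) (at x within V)"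
    using u d by blast
next
  fix u' assume u': "u' \<in> V \<and> (g has_derivative (\<lambda>v. u' \<bullet> v)) (at x within V)"
  define v where "v = u' - u"
  have v: "v \<in> V" unfolding v_def using u u' V by (simp add: subspace_diff)
  have line: "(\<lambda>t::real. x + t *\<^sub>R v) ` UNIV \<subseteq> V"
    using V x v by (auto simp: subspace_add subspace_scale)
  have dl: "((\<lambda>t. x + t *\<^sub>R v) has_derivative (\<lambda>t. t *\<^sub>R v)) (at (0::real))"
    by (auto intro!: derivative_eq_intros)
  have *: "((\<lambda>t. g (x + t *\<^sub>R v)) has_derivative (\<lambda>t. a \<bullet> (t *\<^sub>R v))) (at (0::real))"
    if "(g has_derivative (\<lambda>v. a \<bullet> v)) (at x within V)" for a
  proof -
    have "(g has_derivative (\<lambda>v. a \<bullet> v)) (at (x + 0 *\<^sub>R v) within range (\<lambda>t::real. x + t *\<^sub>R v))"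
      using has_derivative_subset[OF that line] by simp
    from has_derivative_in_compose[OF dl this] show ?thesis by simp
  qed
  have "(\<lambda>t::real. u \<bullet> (t *\<^sub>R v)) = (\<lambda>t. u' \<bullet> (t *\<^sub>R v))"
    using has_derivative_unique[OF *[OF d] *] u' by blast
  then have "u \<bullet> v = u' \<bullet> v" by (metis scaleR_one)
  then have "v \<bullet> v = 0" by (simp add: v_def inner_diff_left)
  then show "u' = u" by (simp add: v_def)
qed

definition pgrad :: "('d::finite \<Rightarrow> nat) \<Rightarrow> (real^'d \<Rightarrow> real) \<Rightarrow> nat \<Rightarrow> real^'d \<Rightarrow> real^'d" where
  "pgrad blk f i z = grad_on (bspace blk i) (\<lambda>w. f (bupd blk i z w)) (bproj blk i z)"

text \<open>Extended-valued distance: it is \<open>\<infinity>\<close> for the empty set, whereas \<open>infdist x {} = 0\<close>.\<close>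

definition edist_set :: "'a::real_normed_vector \<Rightarrow> 'a set \<Rightarrow> ereal" where
  "edist_set w A = (INF w'\<in>A. ereal (norm (w - w')))"

definition feas :: "('d::finite \<Rightarrow> nat) \<Rightarrow> (nat \<Rightarrow> nat) \<Rightarrow> (nat \<Rightarrow> nat \<Rightarrow> real^'d \<Rightarrow> real) \<Rightarrow> nat
    \<Rightarrow> (real^'d) set" where
  "feas blk p h i = {w \<in> bspace blk i. \<forall>j\<in>{1..p i}. h i j w \<le> 0}"

definition feas_bar :: "('d::finite \<Rightarrow> nat) \<Rightarrow> (nat \<Rightarrow> nat) \<Rightarrow> (nat \<Rightarrow> nat \<Rightarrow> real^'d \<Rightarrow> real) \<Rightarrow> real
    \<Rightarrow> nat \<Rightarrow> (real^'d) set" where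
  "feas_bar blk p h eb i = {w \<in> bspace blk i. edist_set w (feas blk p h i) \<le> ereal eb}"

definition M_bar :: "('d::finite \<Rightarrow> nat) \<Rightarrow> nat \<Rightarrow> (nat \<Rightarrow> nat) \<Rightarrow> (nat \<Rightarrow> nat \<Rightarrow> real^'d \<Rightarrow> real)
    \<Rightarrow> (real^'d \<Rightarrow> real) \<Rightarrow> real \<Rightarrow> nat \<Rightarrow> ereal" where
  "M_bar blk n p h f eb i =
     (SUP z\<in>bprod blk n (feas_bar blk p h eb). ereal (norm (pgrad blk f i z)))"

definition feas_tilde :: "('d::finite \<Rightarrow> nat) \<Rightarrow> nat \<Rightarrow> (nat \<Rightarrow> nat)
    \<Rightarrow> (nat \<Rightarrow> nat \<Rightarrow> real^'d \<Rightarrow> real) \<Rightarrow> (real^'d \<Rightarrow> real) \<Rightarrow> real \<Rightarrow> real \<Rightarrow> nat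
    \<Rightarrow> (real^'d) set" where
  "feas_tilde blk n p h f eb Ml i =
     {w \<in> bspace blk i.
        edist_set w (feas_bar blk p h eb i) \<le> M_bar blk n p h f eb i / ereal Ml}"

definition delta_ind :: "'a set \<Rightarrow> 'a \<Rightarrow> ereal" where
  "delta_ind A w = (if w \<in> A then 0 else \<infinity>)"

definition objective :: "('d::finite \<Rightarrow> nat) \<Rightarrow> nat \<Rightarrow> (nat \<Rightarrow> nat)
    \<Rightarrow> (nat \<Rightarrow> nat \<Rightarrow> real^'d \<Rightarrow> real) \<Rightarrow> (real^'d \<Rightarrow> real) \<Rightarrow> real^'d \<Rightarrow> ereal" where
  "objective blk n p h f z =
     ereal (f z) + (\<Sum>i=1..n. delta_ind (feas blk p h i) (bproj blk i z))"

definition frechet_subdiff :: "('a::euclidean_space \<Rightarrow> ereal) \<Rightarrow> 'a \<Rightarrow> 'a set" where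
  "frechet_subdiff G x =
     (if G x < \<infinity>
      then {u. Liminf (at x) (\<lambda>y. (G y - G x - ereal (u \<bullet> (y - x))) / ereal (norm (y - x))) \<ge> 0}
      else {})"

definition stationary :: "('a::euclidean_space \<Rightarrow> ereal) \<Rightarrow> 'a \<Rightarrow> bool" where
  "stationary G x \<longleftrightarrow> 0 \<in> frechet_subdiff G x"

text \<open>On the reals, \<open>powr\<close> satisfies \<open>0 powr 0 = 0\<close>, which is the convention intended below.\<close>

definition abs_epowr :: "ereal \<Rightarrow> real \<Rightarrow> ereal" where
  "abs_epowr a \<theta> = (if \<bar>a\<bar> = \<infinity> then \<infinity> else ereal (\<bar>real_of_ereal a\<bar> powr \<theta>))"

text \<open>If the subdifferential at \<open>x\<close> is empty, the right-hand side of the inequality is \<open>\<infinity>\<close>.\<close>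

definition lojasiewicz_at :: "('a::euclidean_space \<Rightarrow> ereal) \<Rightarrow> 'a \<Rightarrow> bool" where
  "lojasiewicz_at G xb \<longleftrightarrow>
     (\<exists>c>0. \<exists>\<theta>\<in>{0..<1}. \<exists>\<eta>>0. \<forall>x\<in>cball xb \<eta>.
        abs_epowr (G x - G xb) \<theta> \<le> ereal c * edist_set 0 (frechet_subdiff G x))"

definition jac_mult :: "('d::finite \<Rightarrow> nat) \<Rightarrow> (nat \<Rightarrow> nat) \<Rightarrow> (nat \<Rightarrow> nat \<Rightarrow> real^'d \<Rightarrow> real) \<Rightarrow> nat
    \<Rightarrow> real^'d \<Rightarrow> (nat \<Rightarrow> real) \<Rightarrow> real^'d" where
  "jac_mult blk p h i x lam = (\<Sum>j=1..p i. lam j *\<^sub>R grad_on (bspace blk i) (h i j) x)"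

definition residual :: "('d::finite \<Rightarrow> nat) \<Rightarrow> (nat \<Rightarrow> nat) \<Rightarrow> (nat \<Rightarrow> nat \<Rightarrow> real^'d \<Rightarrow> real) \<Rightarrow> nat
    \<Rightarrow> real^'d \<Rightarrow> (nat \<Rightarrow> real) \<Rightarrow> real^'d \<Rightarrow> real" where
  "residual blk p h i x lam xt =
     max (x \<bullet> (x - xt + jac_mult blk p h i x lam)) 0
     + infnorm (x - xt + jac_mult blk p h i x lam)
     + Max ((\<lambda>j. \<bar>max (h i j x) 0\<bar>) ` {1..p i})
     + max (- (\<Sum>j=1..p i. lam j * h i j x)) 0"

text \<open>\<open>mixed blk i z' z\<close> is \<open>(x'_{<i}, x_{\<ge>i})\<close>.\<close>

definition mixed :: "('d::finite \<Rightarrow> nat) \<Rightarrow> nat \<Rightarrow> real^'d \<Rightarrow> real^'d \<Rightarrow> real^'d" where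
  "mixed blk i z' z = (\<chi> d. if blk d < i then z' $ d else z $ d)"

definition palm_target :: "('d::finite \<Rightarrow> nat) \<Rightarrow> (real^'d \<Rightarrow> real) \<Rightarrow> (nat \<Rightarrow> nat \<Rightarrow> real)
    \<Rightarrow> (nat \<Rightarrow> real^'d) \<Rightarrow> nat \<Rightarrow> nat \<Rightarrow> real^'d" where
  "palm_target blk f \<sigma> z k i =
     bproj blk i (z k) - (1 / \<sigma> k i) *\<^sub>R pgrad blk f i (mixed blk i (z (Suc k)) (z k))"

text \<open>\<open>z\<close> is a sequence generated by PALM-I with step parameters \<open>\<sigma> k i\<close>.\<close>

definition palm_I :: "('d::finite \<Rightarrow> nat) \<Rightarrow> nat \<Rightarrow> (nat \<Rightarrow> nat) \<Rightarrow> (nat \<Rightarrow> nat \<Rightarrow> real^'d \<Rightarrow> real)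
    \<Rightarrow> (real^'d \<Rightarrow> real) \<Rightarrow> real \<Rightarrow> (nat \<Rightarrow> real) \<Rightarrow> real \<Rightarrow> real \<Rightarrow> (nat \<Rightarrow> nat \<Rightarrow> real)
    \<Rightarrow> (nat \<Rightarrow> real^'d) \<Rightarrow> bool" where
  "palm_I blk n p h f eb \<epsilon> Ml Mu \<sigma> z \<longleftrightarrow>
     eb > 0 \<and> (\<forall>k. 0 \<le> \<epsilon> k \<and> \<epsilon> k \<le> eb) \<and> 0 < Ml \<and> Ml \<le> Mu \<and>
     (\<forall>k. \<forall>i\<in>{1..n}. \<sigma> k i \<in> {Ml..Mu}) \<and>
     (\<forall>k. \<forall>i\<in>{1..n}. \<exists>lam. (\<forall>j\<in>{1..p i}. 0 \<le> lam j) \<and>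
        sqrt (residual blk p h i (bproj blk i (z (Suc k))) lam (palm_target blk f \<sigma> z k i)) \<le> \<epsilon> k)"

text \<open>``Linear'' constraints, in the optimization sense, are affine ones: a compact feasible set of
  homogeneous ones would be \<open>{0}\<close>.\<close>

definition linear_constr :: "('d::finite \<Rightarrow> nat) \<Rightarrow> (nat \<Rightarrow> nat) \<Rightarrow> (nat \<Rightarrow> nat \<Rightarrow> real^'d \<Rightarrow> real)
    \<Rightarrow> nat \<Rightarrow> bool" where
  "linear_constr blk p h i \<longleftrightarrow>
     (\<forall>j\<in>{1..p i}. \<exists>a c. \<forall>w\<in>bspace blk i. h i j w = a \<bullet> w + c)"

definition slater :: "('d::finite \<Rightarrow> nat) \<Rightarrow> (nat \<Rightarrow> nat) \<Rightarrow> (nat \<Rightarrow> nat \<Rightarrow> real^'d \<Rightarrow> real)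
    \<Rightarrow> nat \<Rightarrow> bool" where
  "slater blk p h i \<longleftrightarrow> (\<exists>w\<in>bspace blk i. \<forall>j\<in>{1..p i}. h i j w < 0)"

end

theory Submission imports Defs begin

text \<open>
  PALM-I is an inexact projected gradient method whose projections onto the factors of
  \<open>S = \<Prod>i. feas i\<close> are computed only up to a small error, and the objective is \<open>f\<close> restricted to \<open>S\<close>.
  A whole sweep \<open>z k \<mapsto> z (Suc k)\<close> is summarized by one vector \<open>v k\<close>, whose block \<open>i\<close> is
  \<open>\<sigma> k i\<close> times the old block minus the new block, minus the partial gradient used.
  The residual test makes \<open>v k\<close> almost normal to \<open>S\<close> at \<open>z (Suc k)\<close>, with error \<open>O((\<epsilon> k)\<^sup>2)\<close>
  (\<open>residual_approx_projection\<close>, \<open>approx_optimality\<close>); the Lipschitz condition makes \<open>- v k\<close> close to the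
  gradient of \<open>f\<close> at \<open>z (Suc k)\<close>, with an error proportional to the step length (\<open>residual_gradient\<close>);
  and since the \<open>\<sigma> k i\<close> exceed the Lipschitz constants, \<open>f\<close> decreases by a multiple of the squared step
  length up to terms in \<open>v k\<close> that are under control (\<open>sweep_descent\<close>). From these properties, collected
  in the locale \<open>inexact_descent\<close>, convergence follows without further reference to blocks.

  The iterates are infeasible, so the Lojasiewicz inequality cannot be applied to them. It is applied
  to shadow points \<open>w k\<close> in \<open>S\<close>, the projections of \<open>z (Suc k) + v k\<close>. The projection supplies an exact
  normal vector, hence a subgradient of size \<open>O(step length + \<epsilon>)\<close>, and the value of \<open>f\<close> at
  \<open>z (Suc k)\<close> exceeds that at \<open>w k\<close> only by a quantity of second order (\<open>projection_estimates\<close>). Adding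
  tails of the series of squared tolerances to \<open>f\<close> gives a monotone energy (\<open>energy\<close>). The Lojasiewicz
  inequality then bounds a power \<open>\<theta>\<close> of the energy above its limit by the length of the previous step plus
  summable errors, where the tails contribute the summable sequence assumed in the theorem because
  \<open>\<theta>\<close> may be increased to at least \<open>\<theta>b\<close>. Such an inequality forces the step lengths to be summable
  (\<open>summable_steps_if_powr_decrease\<close>), so the iterates converge, and the limit is
  stationary because the subgradients at the shadow points tend to 0.

  Two preparations are needed. The Lojasiewicz constants depend on the stationary point, and
  \<open>lojasiewicz_along_sequence\<close> makes them uniform along the sequence. Moreover the hypotheses on the
  enlarged feasible sets say nothing about the first iterates; but the violation of the constraints tends
  to 0, and by \<open>convex_sublevel_near\<close> the iterates eventually enter these sets. For affine constraints
  this presupposes that the feasible set is nonempty, which is \<open>affine_system_feasible\<close>.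
\<close>

section \<open>Sequences with a power-type decrease\<close>

text \<open>
  The tangent inequality of the concave function \<open>t \<mapsto> t powr (1 - \<theta>)\<close> at \<open>x\<close>, multiplied by \<open>x powr \<theta>\<close>
  so that it also makes sense at \<open>x = 0\<close>. It converts a decrease of the energy into a decrease of its
  desingularized value. It comes from the weighted arithmetic-geometric mean inequality, that is,
  from the convexity of \<open>exp\<close>.
\<close>

lemma powr_tangent_bound:
  fixes x y \<theta> :: real
  assumes "0 \<le> y" "y \<le> x" "0 < \<theta>" "\<theta> < 1"
  shows "(1 - \<theta>) * (x - y) \<le> x powr \<theta> * (x powr (1 - \<theta>) - y powr (1 - \<theta>))"
proof (cases "y = 0")
  case True
  then show ?thesis using assms by (cases "x = 0") (simp_all flip: powr_add add: algebra_simps)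
next
  case False
  then have y: "0 < y" and x: "0 < x" using assms by auto
  have "exp (\<theta> * ln x + (1 - \<theta>) * ln y) \<le> \<theta> * exp (ln x) + (1 - \<theta>) * exp (ln y)"
    using convex_onD[OF exp_convex, of "1 - \<theta>" "ln x" "ln y"] assms by simp
  also have "exp (\<theta> * ln x + (1 - \<theta>) * ln y) = x powr \<theta> * y powr (1 - \<theta>)"
    using x y by (simp add: powr_def exp_add)
  finally have "x powr \<theta> * y powr (1 - \<theta>) \<le> \<theta> * x + (1 - \<theta>) * y"
    using x y by simp
  moreover have "x powr \<theta> * x powr (1 - \<theta>) = x"
    using x by (simp flip: powr_add)
  ultimately show ?thesis by (simp add: algebra_simps)
qed

text \<open>
  The finite length argument of Lojasiewicz, for step lengths \<open>D\<close> and energies \<open>H\<close>. With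
  \<open>\<phi> = H powr (1 - \<theta>)\<close> the two inequalities give
  \<open>(D (Suc k))\<^sup>2 \<le> (D k + s k) * (q * (\<phi> k - \<phi> (Suc k)))\<close>, and the arithmetic-geometric mean
  inequality bounds \<open>D (Suc k)\<close> by half of \<open>D k + s k\<close> plus a telescoping term. Since the factor
  in front of \<open>D k\<close> is less than one, summing up absorbs it into the left-hand side.
\<close>

lemma summable_steps_if_powr_decrease:
  fixes D H s :: "nat \<Rightarrow> real"
  assumes D: "\<And>k. 0 \<le> D k" and H: "\<And>k. 0 \<le> H k" and s: "\<And>k. 0 \<le> s k" "summable s"
    and a: "0 < a" and C: "0 < C" and \<theta>: "0 < \<theta>" "\<theta> < 1"
    and dec: "\<And>k. a * (D k)\<^sup>2 \<le> H k - H (Suc k)"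
    and kl: "\<And>k. H (Suc k) powr \<theta> \<le> C * (D k + s k)"
  shows "summable D"
proof -
  define \<phi> where "\<phi> k = H (Suc k) powr (1 - \<theta>)" for k
  define q where "q = C / (a * (1 - \<theta>))"
  have q: "0 < q" using a C \<theta> by (simp add: q_def)
  have \<phi>: "\<phi> k \<ge> 0" for k by (simp add: \<phi>_def)
  have amgm: "x * y \<le> ((x + y) / 2)\<^sup>2" for x y :: real
    using zero_le_power2[of "x - y"] by (simp add: power2_eq_square field_simps)
  have step: "D (Suc k) \<le> (D k + s k) / 2 + (q / 2) * (\<phi> k - \<phi> (Suc k))" for k
  proof -
    have mono: "H (Suc (Suc k)) \<le> H (Suc k)"
      using dec[of "Suc k"] a by (smt (verit) mult_nonneg_nonneg zero_le_power2)
    have \<phi>m: "\<phi> (Suc k) \<le> \<phi> k"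
      unfolding \<phi>_def using mono H \<theta> by (intro powr_mono2) auto
    have "(1 - \<theta>) * (a * (D (Suc k))\<^sup>2) \<le> (1 - \<theta>) * (H (Suc k) - H (Suc (Suc k)))"
      using dec[of "Suc k"] \<theta> by (intro mult_left_mono) auto
    also have "\<dots> \<le> H (Suc k) powr \<theta> * (\<phi> k - \<phi> (Suc k))"
      unfolding \<phi>_def using H mono \<theta> by (intro powr_tangent_bound) auto
    also have "\<dots> \<le> C * (D k + s k) * (\<phi> k - \<phi> (Suc k))"
      using kl[of k] \<phi>m by (intro mult_right_mono) auto
    finally have "(D (Suc k))\<^sup>2 \<le> (D k + s k) * (q * (\<phi> k - \<phi> (Suc k)))"
      using a \<theta> by (simp add: q_def field_simps)
    also have "\<dots> \<le> (((D k + s k) + q * (\<phi> k - \<phi> (Suc k))) / 2)\<^sup>2"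
      using amgm by blast
    finally have "D (Suc k) \<le> ((D k + s k) + q * (\<phi> k - \<phi> (Suc k))) / 2"
      by (rule power2_le_imp_le) (use D[of k] s(1)[of k] q \<phi>m in auto)
    then show ?thesis by (simp add: field_simps)
  qed
  have bound: "(\<Sum>k<N. D (Suc k)) \<le> D 0 + suminf s + q * \<phi> 0" for N
  proof -
    have "(\<Sum>k<N. D (Suc k)) \<le> (\<Sum>k<N. (D k + s k) / 2 + (q / 2) * (\<phi> k - \<phi> (Suc k)))"
      by (intro sum_mono step)
    also have "\<dots> = ((\<Sum>k<N. D k) + (\<Sum>k<N. s k)) / 2 + (q / 2) * (\<phi> 0 - \<phi> N)"
      by (simp add: sum.distrib sum_divide_distrib[symmetric] sum_distrib_left[symmetric]
          sum_lessThan_telescope')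
    finally have "2 * (\<Sum>k<N. D (Suc k)) \<le> (\<Sum>k<N. D k) + (\<Sum>k<N. s k) + q * (\<phi> 0 - \<phi> N)"
      by (simp add: field_simps)
    moreover have "(\<Sum>k<N. D k) \<le> D 0 + (\<Sum>k<N. D (Suc k))"
      using D sum.lessThan_Suc_shift[of D N] by (simp add: sum.lessThan_Suc) (smt (verit) D)
    moreover have "(\<Sum>k<N. s k) \<le> suminf s"
      using s by (intro sum_le_suminf) auto
    moreover have "q * (\<phi> 0 - \<phi> N) \<le> q * \<phi> 0"
      using q \<phi>[of N] by (intro mult_left_mono) auto
    ultimately show ?thesis by linarith
  qed
  have "summable (\<lambda>k. D (Suc k))"
    using bound D by (intro summableI_nonneg_bounded) auto
  then show ?thesis by (simp add: summable_Suc_iff)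
qed

section \<open>Subgradients and the Lojasiewicz inequality for constrained functions\<close>

abbreviation constrained :: "('a \<Rightarrow> real) \<Rightarrow> 'a set \<Rightarrow> 'a \<Rightarrow> ereal" where
  "constrained f S \<equiv> \<lambda>x. ereal (f x) + delta_ind S x"

text \<open>
  The subgradients that the convergence proof needs come from normal vectors. Off \<open>S\<close> the difference
  quotient is infinite, and on \<open>S\<close> a normal vector only increases it.
\<close>

lemma grad_plus_normal_in_frechet_subdiff:
  fixes f :: "'a::euclidean_space \<Rightarrow> real"
  assumes x: "x \<in> S" and f': "(f has_derivative (\<lambda>h. g \<bullet> h)) (at x)"
    and normal: "\<And>y. y \<in> S \<Longrightarrow> n \<bullet> (y - x) \<le> 0"
  shows "g + n \<in> frechet_subdiff (constrained f S) x"
proof -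
  define F where "F = (\<lambda>x. ereal (f x) + delta_ind S x)"
  have Fx: "F x = ereal (f x)" using x by (simp add: F_def delta_ind_def)
  have "0 \<le> Liminf (at x) (\<lambda>y. (F y - F x - ereal ((g + n) \<bullet> (y - x))) / ereal (norm (y - x)))"
    unfolding le_Liminf_iff
  proof (intro allI impI)
    fix c :: ereal assume "c < 0"
    then obtain e where e: "0 < e" "c < ereal (- e)"
    proof (cases c)
      case (real r)
      then show ?thesis using \<open>c < 0\<close> that[of "- r / 2"] by auto
    qed (use that[of 1] in auto)
    from f' e(1) obtain d where d: "0 < d"
      "\<And>y. norm (y - x) < d \<Longrightarrow> norm (f y - f x - g \<bullet> (y - x)) \<le> e * norm (y - x)"
      unfolding has_derivative_at_alt by blast
    have "c < (F y - F x - ereal ((g + n) \<bullet> (y - x))) / ereal (norm (y - x))"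
      if y: "y \<noteq> x" "dist y x < d" for y
    proof (cases "y \<in> S")
      case True
      have pos: "0 < norm (y - x)" using y by simp
      have "\<bar>f y - f x - g \<bullet> (y - x)\<bar> \<le> e * norm (y - x)"
        using d(2)[of y] y by (simp add: dist_norm)
      then have "- e * norm (y - x) \<le> f y - f x - (g + n) \<bullet> (y - x)"
        using normal[OF True] by (simp add: inner_add_left)
      then have "- e \<le> (f y - f x - (g + n) \<bullet> (y - x)) / norm (y - x)"
        using pos by (simp add: pos_le_divide_eq)
      then show ?thesis
        using e(2) True pos unfolding Fx by (auto simp: F_def delta_ind_def intro: less_le_trans)
    next
      case False
      then show ?thesis
        using e(2) y unfolding Fx
        by (auto simp: F_def delta_ind_def intro: less_trans)
    qed
    then show "\<forall>\<^sub>F y in at x. c < (F y - F x - ereal ((g + n) \<bullet> (y - x))) / ereal (norm (y - x))"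
      unfolding eventually_at using d(1) by auto
  qed
  then show ?thesis
    using Fx unfolding frechet_subdiff_def F_def by auto
qed

text \<open>
  Closedness of the graph of \<open>G\<close> plus the normal cone: the normal vectors converge to \<open>- G l\<close>, and a
  limit of normal vectors is normal.
\<close>

lemma stationary_limit_of_projections:
  fixes f :: "'a::euclidean_space \<Rightarrow> real"
  assumes S: "closed S" and w: "\<And>k. w k \<in> S" and wl: "w \<longlonglongrightarrow> l"
    and f': "(f has_derivative (\<lambda>h. G l \<bullet> h)) (at l)"
    and G: "continuous (at l within S) G"
    and normal: "\<And>k y. y \<in> S \<Longrightarrow> n k \<bullet> (y - w k) \<le> 0"
    and u: "(\<lambda>k. G (w k) + n k) \<longlonglongrightarrow> 0"
  shows "stationary (constrained f S) l"
proof -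
  have l: "l \<in> S" by (rule closed_sequentially[OF S w wl])
  have Gw: "(\<lambda>k. G (w k)) \<longlonglongrightarrow> G l"
    by (rule continuous_within_tendsto_compose'[OF G w wl])
  have n: "n \<longlonglongrightarrow> - G l"
    using tendsto_diff[OF u Gw] by simp
  have "G l + (- G l) \<in> frechet_subdiff (constrained f S) l"
  proof (rule grad_plus_normal_in_frechet_subdiff[OF l f'])
    fix y assume "y \<in> S"
    then have "(\<lambda>k. n k \<bullet> (y - w k)) \<longlonglongrightarrow> - G l \<bullet> (y - l)"
      by (intro tendsto_intros n wl)
    then show "- G l \<bullet> (y - l) \<le> 0"
      using normal[OF \<open>y \<in> S\<close>] by (intro LIMSEQ_le_const2) auto
  qed
  then show ?thesis by (simp add: stationary_def)
qed

text \<open>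
  The Lojasiewicz inequality is assumed pointwise, with constants that depend on the stationary point,
  and the sequence may have many cluster points. One exponent and one constant nevertheless serve the
  whole tail of the sequence: otherwise the inequality fails along a subsequence for exponents
  tending to 1 and constants tending to infinity. That subsequence has a cluster point, which is
  stationary with value \<open>fs\<close>, and near it the inequality holds with a fixed exponent below 1 and a
  fixed constant. Since raising the exponent only weakens the inequality while the values differ by at
  most 1, this is a contradiction.
\<close>

lemma lojasiewicz_along_sequence:
  fixes f :: "'a::euclidean_space \<Rightarrow> real"
  assumes S: "compact S" and w: "\<And>k. w k \<in> S"
    and f': "\<And>x. (f has_derivative (\<lambda>h. G x \<bullet> h)) (at x)"
    and G: "continuous_on S G"
    and normal: "\<And>k y. y \<in> S \<Longrightarrow> n k \<bullet> (y - w k) \<le> 0"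
    and u: "(\<lambda>k. G (w k) + n k) \<longlonglongrightarrow> 0"
    and fw: "(\<lambda>k. f (w k)) \<longlonglongrightarrow> fs"
    and loj: "\<And>x. stationary (constrained f S) x \<Longrightarrow> lojasiewicz_at (constrained f S) x"
    and \<theta>0: "\<theta>0 < 1"
  obtains \<theta> c where "\<theta>0 \<le> \<theta>" "\<theta> < 1" "0 < c"
    "\<forall>\<^sub>F k in sequentially. \<bar>f (w k) - fs\<bar> powr \<theta> \<le> c * norm (G (w k) + n k)"
proof (rule ccontr)
  assume "\<not> thesis"
  with that have neg: "\<And>\<theta> c. \<theta>0 \<le> \<theta> \<Longrightarrow> \<theta> < 1 \<Longrightarrow> 0 < c \<Longrightarrow>
      \<not> (\<forall>\<^sub>F k in sequentially. \<bar>f (w k) - fs\<bar> powr \<theta> \<le> c * norm (G (w k) + n k))"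
    by blast
  let ?F = "constrained f S"
  define \<tau> where "\<tau> m = max \<theta>0 (1 - 1 / real (m + 2))" for m
  have "\<exists>k\<ge>m. real (m + 1) * norm (G (w k) + n k) < \<bar>f (w k) - fs\<bar> powr \<tau> m" for m
    using neg[of "\<tau> m" "real (m + 1)"] \<theta>0
    by (auto simp: \<tau>_def eventually_sequentially not_le)
  then obtain K where K: "\<And>m. m \<le> K m"
    "\<And>m. real (m + 1) * norm (G (w (K m)) + n (K m)) < \<bar>f (w (K m)) - fs\<bar> powr \<tau> m"
    by metis
  obtain l r where l: "l \<in> S" and r: "strict_mono r" "(\<lambda>m. w (K (r m))) \<longlonglongrightarrow> l"
    using S w unfolding compact_eq_seq_compact_metric seq_compact_def comp_def by meson
  have Kr: "filterlim (\<lambda>m. K (r m)) sequentially sequentially"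
    by (rule filterlim_at_top_mono[OF filterlim_ident])
      (auto intro!: always_eventually intro: order_trans[OF seq_suble[OF r(1)] K(1)])
  have u0: "(\<lambda>m. G (w (K (r m))) + n (K (r m))) \<longlonglongrightarrow> 0"
    using filterlim_compose[OF u Kr] .
  have fw0: "(\<lambda>m. f (w (K (r m)))) \<longlonglongrightarrow> fs"
    using filterlim_compose[OF fw Kr] .
  have "(\<lambda>m. f (w (K (r m)))) \<longlonglongrightarrow> f l"
    using has_derivative_continuous[OF f'] r(2) by (rule isCont_tendsto_compose)
  then have fl: "f l = fs" using fw0 LIMSEQ_unique by blast
  have "stationary ?F l"
    by (rule stationary_limit_of_projections[where G = G and w = "\<lambda>m. w (K (r m))" and n = "\<lambda>m. n (K (r m))"])
      (use S w r(2) f' G l normal u0 in \<open>auto simp: compact_imp_closed continuous_on_eq_continuous_within\<close>)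
  then have "lojasiewicz_at ?F l" by (rule loj)
  then obtain c \<theta> \<eta> where c: "0 < c" and \<theta>: "\<theta> \<in> {0..<1}" and \<eta>: "0 < \<eta>"
    and ineq: "\<And>x. x \<in> cball l \<eta> \<Longrightarrow>
      abs_epowr (?F x - ?F l) \<theta> \<le> ereal c * edist_set 0 (frechet_subdiff ?F x)"
    unfolding lojasiewicz_at_def by blast
  have "\<forall>\<^sub>F m in sequentially. dist (w (K (r m))) l < \<eta>"
    using r(2) \<eta> by (rule tendstoD)
  moreover have "\<forall>\<^sub>F m in sequentially. dist (f (w (K (r m)))) fs < 1"
    using fw0 by (rule tendstoD) simp
  moreover have "\<forall>\<^sub>F m in sequentially. c \<le> real m"
    using filterlim_real_sequentially by (simp add: filterlim_at_top)
  moreover have "\<forall>\<^sub>F m in sequentially. 1 / (1 - \<theta>) \<le> real m"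
    using filterlim_real_sequentially by (simp add: filterlim_at_top)
  ultimately have "\<forall>\<^sub>F m in sequentially. False"
  proof eventually_elim
    case (elim m)
    define k where "k = K (r m)"
    have rm: "m \<le> r m" by (rule seq_suble[OF r(1)])
    have FS: "?F (w k) - ?F l = ereal (f (w k) - fs)"
      using w l fl by (simp add: delta_ind_def)
    have sub: "G (w k) + n k \<in> frechet_subdiff ?F (w k)"
      by (rule grad_plus_normal_in_frechet_subdiff[OF w f' normal])
    have "edist_set 0 (frechet_subdiff ?F (w k)) \<le> ereal (norm (0 - (G (w k) + n k)))"
      unfolding edist_set_def using sub by (rule INF_lower)
    also have "norm (0 - (G (w k) + n k)) = norm (G (w k) + n k)"
      by (simp only: diff_0 norm_minus_cancel)
    finally have up: "ereal c * edist_set 0 (frechet_subdiff ?F (w k)) \<le> ereal (c * norm (G (w k) + n k))"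
      using c ereal_mult_left_mono[of _ "ereal (norm (G (w k) + n k))" "ereal c"] by simp
    have "ereal (\<bar>f (w k) - fs\<bar> powr \<theta>) = abs_epowr (?F (w k) - ?F l) \<theta>"
      unfolding FS by (simp add: abs_epowr_def)
    also have "\<dots> \<le> ereal c * edist_set 0 (frechet_subdiff ?F (w k))"
      by (rule ineq) (use elim(1) in \<open>simp add: k_def dist_commute\<close>)
    also note up
    finally have 1: "\<bar>f (w k) - fs\<bar> powr \<theta> \<le> c * norm (G (w k) + n k)"
      by simp
    have "1 / real (r m + 2) \<le> 1 - \<theta>"
    proof -
      have "1 / (1 - \<theta>) \<le> real (r m + 2)" using elim(4) rm by linarith
      then show ?thesis using \<theta> by (simp add: field_simps)
    qed
    then have "\<theta> \<le> \<tau> (r m)" unfolding \<tau>_def by linarith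
    then have "\<bar>f (w k) - fs\<bar> powr \<tau> (r m) \<le> \<bar>f (w k) - fs\<bar> powr \<theta>"
      using elim(2) by (intro powr_mono') (auto simp: k_def dist_real_def)
    also note 1
    also have "c * norm (G (w k) + n k) \<le> real (r m + 1) * norm (G (w k) + n k)"
      using elim(3) rm by (intro mult_right_mono) auto
    finally show False using K(2)[of "r m"] by (simp add: k_def)
  qed
  then show False by simp
qed

section \<open>Convergence of inexact descent sequences\<close>

text \<open>
  A descent lemma obtained from the mean value theorem. For a gradient with Lipschitz constant \<open>\<Lambda>\<close> it
  gives the quadratic term \<open>\<Lambda> * (norm d)\<^sup>2\<close>, twice the optimal one. Assuming the bound only along the
  segment allows it to be used for a single block of variables with its own constant.
\<close>

lemma gradient_step_upper_bound:
  fixes f :: "'a::real_inner \<Rightarrow> real"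
  assumes f': "\<And>x. (f has_derivative (\<lambda>h. G x \<bullet> h)) (at x)"
    and le: "\<And>t. t \<in> {0..1} \<Longrightarrow> (G (x + t *\<^sub>R d) - G x) \<bullet> d \<le> c"
  shows "f (x + d) \<le> f x + G x \<bullet> d + c"
proof -
  have "((\<lambda>t. f (x + t *\<^sub>R d)) has_derivative (\<lambda>s. G (x + t *\<^sub>R d) \<bullet> (s *\<^sub>R d))) (at t within {0..1})" for t
  proof -
    have "((\<lambda>t. x + t *\<^sub>R d) has_derivative (\<lambda>s. s *\<^sub>R d)) (at t within {0..1})"
      by (auto intro!: derivative_eq_intros)
    then show ?thesis
      by (rule has_derivative_compose) (rule f')
  qed
  then obtain t where t: "t \<in> {0..1}" "f (x + 1 *\<^sub>R d) - f (x + 0 *\<^sub>R d) = G (x + t *\<^sub>R d) \<bullet> ((1 - 0) *\<^sub>R d)"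
    using mvt_very_simple[of 0 1 "\<lambda>t. f (x + t *\<^sub>R d)" "\<lambda>t s. G (x + t *\<^sub>R d) \<bullet> (s *\<^sub>R d)"] by auto
  then show ?thesis using le[OF t(1)] by (simp add: inner_diff_left)
qed

lemma powr_sum3_le:
  fixes x y z \<theta> :: real
  assumes "0 \<le> x" "0 \<le> y" "0 \<le> z" and \<theta>: "0 \<le> \<theta>" "\<theta> \<le> 1"
  shows "(x + y + z) powr \<theta> \<le> 3 * (x powr \<theta> + y powr \<theta> + z powr \<theta>)"
proof -
  define m where "m = max x (max y z)"
  have m: "0 \<le> m" "x + y + z \<le> 3 * m" using assms by (auto simp: m_def)
  have "(x + y + z) powr \<theta> \<le> (3 * m) powr \<theta>" using assms m by (intro powr_mono2) auto
  also have "\<dots> = 3 powr \<theta> * m powr \<theta>" using m by (simp add: powr_mult)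
  also have "\<dots> \<le> 3 powr 1 * m powr \<theta>" using \<theta> by (intro mult_right_mono powr_mono) auto
  also have "m powr \<theta> \<le> x powr \<theta> + y powr \<theta> + z powr \<theta>"
    unfolding m_def max_def by auto
  finally show ?thesis by simp
qed

text \<open>
  What a run of the algorithm amounts to once the blocks are put together. The vector \<open>v k\<close> is an
  approximate normal vector of \<open>S\<close> at \<open>z (Suc k)\<close> (assumption \<open>opt\<close>) and an approximation of
  \<open>- G (z (Suc k))\<close> (assumption \<open>res\<close>), while \<open>dec\<close> is the effect of a step on \<open>f\<close>. The iterates lie
  in the region \<open>B\<close> where the gradient is Lipschitz, but only close to \<open>S\<close>.
  The tolerance \<open>e\<close> is indexed by the iterate that it controls, not by the step that produces it.
\<close>

locale inexact_descent =
  fixes f :: "'a::euclidean_space \<Rightarrow> real" and G :: "'a \<Rightarrow> 'a" and S B :: "'a set"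
    and z v :: "nat \<Rightarrow> 'a" and e :: "nat \<Rightarrow> real" and \<Lambda> a C :: real
  assumes S: "convex S" "compact S" "S \<noteq> {}" "S \<subseteq> B"
    and B: "convex B" "bounded B"
    and f': "\<And>x. (f has_derivative (\<lambda>h. G x \<bullet> h)) (at x)"
    and lipschitz: "\<And>x y. x \<in> B \<Longrightarrow> y \<in> B \<Longrightarrow> norm (G x - G y) \<le> \<Lambda> * norm (x - y)"
    and zB: "\<And>k. z k \<in> B"
    and near: "\<And>k. infdist (z k) S \<le> C * (e k)\<^sup>2"
    and opt: "\<And>k y. y \<in> S \<Longrightarrow> (y - z (Suc k)) \<bullet> v k \<le> C * (e (Suc k))\<^sup>2"
    and res: "\<And>k. norm (v k + G (z (Suc k))) \<le> C * norm (z (Suc k) - z k)"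
    and dec: "\<And>k. f (z (Suc k)) \<le> f (z k) - v k \<bullet> (z (Suc k) - z k) - a * (norm (z (Suc k) - z k))\<^sup>2"
    and const: "0 \<le> \<Lambda>" "0 < a" "0 \<le> C"
    and e: "\<And>k. 0 \<le> e k" "summable e"
begin

definition "\<Delta> k = norm (z (Suc k) - z k)"
definition "E k = (\<Sum>t. (e (k + t))\<^sup>2)"
text \<open>
  The shadow \<open>w k\<close> is a feasible point near \<open>z (Suc k)\<close>. Projecting \<open>z (Suc k) + v k\<close> and not
  \<open>z (Suc k)\<close> itself makes \<open>n k\<close> an exact normal vector of \<open>S\<close> at \<open>w k\<close> that is close to \<open>v k\<close>, so that
  \<open>G (w k) + n k\<close> is a small subgradient.
\<close>

definition "w k = closest_point S (z (Suc k) + v k)"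
definition "n k = z (Suc k) + v k - w k"

lemma closed_S: "closed S" by (rule compact_imp_closed[OF S(2)])

lemma w_in: "w k \<in> S"
  unfolding w_def by (rule closest_point_in_set[OF closed_S S(3)])

lemma n_normal: "y \<in> S \<Longrightarrow> n k \<bullet> (y - w k) \<le> 0"
  unfolding n_def w_def by (rule closest_point_dot[OF S(1) closed_S])

lemma nearest:
  obtains q where "q \<in> S" "norm (z k - q) \<le> C * (e k)\<^sup>2"
  using infdist_attains_inf[OF closed_S S(3), of "z k"] near[of k] by (metis dist_norm)

lemma obtain_bounds:
  obtains R where "0 \<le> R" "\<And>x. x \<in> B \<Longrightarrow> norm x \<le> R" "\<And>x. x \<in> B \<Longrightarrow> norm (G x) \<le> R"
    "\<And>k. norm (v k) \<le> R" "\<And>k. norm (n k) \<le> R"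
proof -
  obtain R1 where R1: "0 < R1" "\<And>x. x \<in> B \<Longrightarrow> norm x \<le> R1"
    using B(2) unfolding bounded_pos by blast
  obtain s where s: "s \<in> S" using S(3) by blast
  define R2 where "R2 = norm (G s) + \<Lambda> * (2 * R1)"
  have G2: "norm (G x) \<le> R2" if "x \<in> B" for x
  proof -
    have "norm (G x) \<le> norm (G s) + norm (G x - G s)" using norm_triangle_sub by blast
    also have "norm (G x - G s) \<le> \<Lambda> * norm (x - s)" using that s S(4) by (intro lipschitz) auto
    also have "\<dots> \<le> \<Lambda> * (2 * R1)"
      using const(1) norm_triangle_ineq4[of x s] R1(2)[OF that] R1(2)[of s] s S(4)
      by (intro mult_left_mono) auto
    finally show ?thesis by (simp add: R2_def)
  qed
  define R3 where "R3 = C * (2 * R1) + R2"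
  have v3: "norm (v k) \<le> R3" for k
  proof -
    have "norm (v k) \<le> norm (v k + G (z (Suc k))) + norm (G (z (Suc k)))"
      using norm_triangle_ineq4[of "v k + G (z (Suc k))" "G (z (Suc k))"] by simp
    also have "norm (v k + G (z (Suc k))) \<le> C * norm (z (Suc k) - z k)" by (rule res)
    also have "\<dots> \<le> C * (2 * R1)"
      using const(3) norm_triangle_ineq4[of "z (Suc k)" "z k"] R1(2)[OF zB[of "Suc k"]] R1(2)[OF zB[of k]]
      by (intro mult_left_mono) auto
    finally show ?thesis using G2[OF zB[of "Suc k"]] by (simp add: R3_def)
  qed
  have n4: "norm (n k) \<le> 2 * R1 + R3" for k
  proof -
    have "norm (n k) \<le> norm (z (Suc k) + v k - s)"
      using closest_point_le[OF closed_S s, of "z (Suc k) + v k"] by (simp add: n_def w_def dist_norm)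
    also have "\<dots> \<le> norm (z (Suc k)) + norm (v k) + norm s"
      using norm_triangle_ineq4[of "z (Suc k) + v k" s] norm_triangle_ineq[of "z (Suc k)" "v k"] by linarith
    finally show ?thesis using R1(2)[OF zB[of "Suc k"]] R1(2)[of s] s S(4) v3[of k] by force
  qed
  have nn: "0 \<le> R1" "0 \<le> R2" "0 \<le> R3"
    using R1 const by (auto simp: R2_def R3_def intro!: add_nonneg_nonneg mult_nonneg_nonneg)
  show thesis
  proof (rule that[of "2 * R1 + R2 + R3"])
    show "norm (v k) \<le> 2 * R1 + R2 + R3" for k using v3[of k] nn by linarith
    show "norm (n k) \<le> 2 * R1 + R2 + R3" for k using n4[of k] nn by linarith
    show "norm x \<le> 2 * R1 + R2 + R3" if "x \<in> B" for x using R1(2)[OF that] nn by linarith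
    show "norm (G x) \<le> 2 * R1 + R2 + R3" if "x \<in> B" for x using G2[OF that] nn by linarith
  qed (use nn in linarith)
qed

lemma f_upper:
  assumes "x \<in> B" "y \<in> B"
  shows "f y \<le> f x + G x \<bullet> (y - x) + \<Lambda> * (norm (y - x))\<^sup>2"
proof -
  have "f (x + (y - x)) \<le> f x + G x \<bullet> (y - x) + \<Lambda> * (norm (y - x))\<^sup>2"
  proof (rule gradient_step_upper_bound[OF f'])
    fix t :: real assume t: "t \<in> {0..1}"
    have xt: "x + t *\<^sub>R (y - x) \<in> B"
      using convexD_alt[OF B(1) assms, of t] t by (simp add: algebra_simps)
    have "(G (x + t *\<^sub>R (y - x)) - G x) \<bullet> (y - x) \<le> norm (G (x + t *\<^sub>R (y - x)) - G x) * norm (y - x)"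
      by (rule norm_cauchy_schwarz)
    also have "\<dots> \<le> (\<Lambda> * norm (t *\<^sub>R (y - x))) * norm (y - x)"
      using lipschitz[OF xt assms(1)] by (intro mult_right_mono) auto
    also have "\<dots> \<le> (\<Lambda> * norm (y - x)) * norm (y - x)"
      using t const(1) by (intro mult_right_mono mult_left_mono) (auto intro: mult_left_le_one_le)
    finally show "(G (x + t *\<^sub>R (y - x)) - G x) \<bullet> (y - x) \<le> \<Lambda> * (norm (y - x))\<^sup>2"
      by (simp add: power2_eq_square mult.assoc)
  qed
  then show ?thesis by simp
qed

lemma G_cont: "continuous_on B G"
proof (rule continuous_onI)
  fix x and \<epsilon> :: real assume x: "x \<in> B" and \<epsilon>: "0 < \<epsilon>"
  show "\<exists>d>0. \<forall>x'\<in>B. dist x' x < d \<longrightarrow> dist (G x') (G x) \<le> \<epsilon>"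
  proof (intro exI[of _ "\<epsilon> / (\<Lambda> + 1)"] conjI ballI impI)
    show "0 < \<epsilon> / (\<Lambda> + 1)" using \<epsilon> const(1) by simp
    fix x' assume x': "x' \<in> B" "dist x' x < \<epsilon> / (\<Lambda> + 1)"
    have "dist (G x') (G x) \<le> \<Lambda> * norm (x' - x)" using lipschitz[OF x'(1) x] by (simp add: dist_norm)
    also have "\<dots> \<le> (\<Lambda> + 1) * dist x' x" by (simp add: dist_norm algebra_simps)
    also have "\<dots> \<le> \<epsilon>" using x'(2) const(1) by (simp add: field_simps)
    finally show "dist (G x') (G x) \<le> \<epsilon>" .
  qed
qed

lemma summable_e2: "summable (\<lambda>t. (e (k + t))\<^sup>2)"
proof -
  have "\<forall>\<^sub>F t in sequentially. e t < 1"
    using order_tendstoD(2)[OF summable_LIMSEQ_zero[OF e(2)], of 1] by simp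
  then have "\<forall>\<^sub>F t in sequentially. norm ((e t)\<^sup>2) \<le> e t"
    by eventually_elim (simp add: power2_eq_square e(1) mult_left_le)
  then have "summable (\<lambda>t. (e t)\<^sup>2)"
    using e(2) by (rule summable_comparison_test_ev)
  then show ?thesis
    using summable_iff_shift[of "\<lambda>t. (e t)\<^sup>2" k] by (simp add: add.commute)
qed

lemma E_nonneg: "0 \<le> E k"
  unfolding E_def by (intro suminf_nonneg summable_e2) simp

lemma E_Suc: "E k = (e k)\<^sup>2 + E (Suc k)"
  unfolding E_def using suminf_split_head[OF summable_e2[of k]] by simp

lemma E_tendsto: "E \<longlonglongrightarrow> 0"
  using suminf_exist_split2[of "\<lambda>t. (e t)\<^sup>2"] summable_e2[of 0]
  by (simp add: E_def[abs_def] add.commute)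

lemma e_tendsto: "e \<longlonglongrightarrow> 0"
  by (rule summable_LIMSEQ_zero[OF e(2)])

text \<open>
  Testing \<open>opt\<close> with a feasible point near \<open>z k\<close> bounds the term \<open>- v k \<bullet> (z (Suc k) - z k)\<close> of \<open>dec\<close> by
  a multiple of \<open>(e k)\<^sup>2 + (e (Suc k))\<^sup>2\<close>. Adding the tails \<open>E k + E (Suc k)\<close> of the series of these errors
  to \<open>f (z k)\<close> therefore gives an energy that decreases monotonically, although \<open>f (z k)\<close> need not.
\<close>

lemma energy:
  obtains c fs where "0 \<le> c" "\<And>k. a * (\<Delta> k)\<^sup>2 \<le> (f (z k) + c * (E k + E (Suc k))) - (f (z (Suc k)) + c * (E (Suc k) + E (Suc (Suc k))))"
    "\<And>k. fs \<le> f (z k) + c * (E k + E (Suc k))" "(\<lambda>k. f (z k)) \<longlonglongrightarrow> fs" "\<Delta> \<longlonglongrightarrow> 0"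
proof -
  obtain R where R: "0 \<le> R" "\<And>x. x \<in> B \<Longrightarrow> norm x \<le> R" "\<And>x. x \<in> B \<Longrightarrow> norm (G x) \<le> R"
    "\<And>k. norm (v k) \<le> R"
    using obtain_bounds by metis
  define c where "c = C + C * R"
  have c: "0 \<le> c" using R const by (simp add: c_def)
  define P where "P k = f (z k) + c * (E k + E (Suc k))" for k
  have step: "a * (\<Delta> k)\<^sup>2 \<le> P k - P (Suc k)" for k
  proof -
    obtain q where q: "q \<in> S" "norm (z k - q) \<le> C * (e k)\<^sup>2" by (rule nearest)
    have "(z k - q) \<bullet> v k \<le> norm (z k - q) * norm (v k)" by (rule norm_cauchy_schwarz)
    also have "\<dots> \<le> (C * (e k)\<^sup>2) * R"
      using q R const by (intro mult_mono) auto
    finally have "(z k - q) \<bullet> v k \<le> (C * R) * (e k)\<^sup>2" by (simp add: mult_ac)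
    moreover have "(q - z (Suc k)) \<bullet> v k \<le> C * (e (Suc k))\<^sup>2" by (rule opt[OF q(1)])
    ultimately have "- (v k \<bullet> (z (Suc k) - z k)) \<le> (C * R) * (e k)\<^sup>2 + C * (e (Suc k))\<^sup>2"
      by (simp add: inner_diff_left inner_diff_right inner_commute)
    also have "\<dots> \<le> c * (e k)\<^sup>2 + c * (e (Suc k))\<^sup>2"
      unfolding c_def using const R by (intro add_mono mult_right_mono) auto
    finally have "f (z (Suc k)) \<le> f (z k) + c * (e k)\<^sup>2 + c * (e (Suc k))\<^sup>2 - a * (\<Delta> k)\<^sup>2"
      using dec[of k] by (simp add: \<Delta>_def)
    then show ?thesis
      unfolding P_def by (subst (1) E_Suc, subst (2) E_Suc) (simp add: algebra_simps)
  qed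
  obtain s where s: "s \<in> S" using S(3) by blast
  have lower: "f s - (R * (2 * R) + \<Lambda> * (2 * R)\<^sup>2) \<le> P k" for k
  proof -
    have zs: "norm (s - z k) \<le> 2 * R"
      using norm_triangle_ineq4[of s "z k"] R(2)[OF zB[of k]] R(2)[of s] s S(4) by force
    have "f s \<le> f (z k) + G (z k) \<bullet> (s - z k) + \<Lambda> * (norm (s - z k))\<^sup>2"
      using s S(4) zB by (intro f_upper) auto
    also have "G (z k) \<bullet> (s - z k) \<le> norm (G (z k)) * norm (s - z k)" by (rule norm_cauchy_schwarz)
    also have "\<dots> \<le> R * (2 * R)" using R zB zs by (intro mult_mono) auto
    also have "\<Lambda> * (norm (s - z k))\<^sup>2 \<le> \<Lambda> * (2 * R)\<^sup>2"
      using zs const by (intro mult_left_mono power_mono) auto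
    finally show ?thesis
      unfolding P_def using c E_nonneg[of k] E_nonneg[of "Suc k"]
      by (smt (verit) mult_nonneg_nonneg)
  qed
  have "P (Suc k) \<le> P k" for k
    using step[of k] const(2) by (smt (verit) mult_nonneg_nonneg zero_le_power2)
  then have "decseq P" by (rule decseq_SucI)
  then obtain fs where fs: "P \<longlonglongrightarrow> fs" "\<forall>k. fs \<le> P k"
    using lower by (blast intro: decseq_convergent)
  have "(\<lambda>k. P k - c * (E k + E (Suc k))) \<longlonglongrightarrow> fs - c * (0 + 0)"
    by (intro tendsto_intros fs E_tendsto LIMSEQ_Suc)
  then have fz: "(\<lambda>k. f (z k)) \<longlonglongrightarrow> fs" by (simp add: P_def)
  have "(\<lambda>k. (P k - P (Suc k)) / a) \<longlonglongrightarrow> (fs - fs) / a"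
    by (intro tendsto_intros fs LIMSEQ_Suc) (use const in auto)
  then have lim0: "(\<lambda>k. (P k - P (Suc k)) / a) \<longlonglongrightarrow> 0" by simp
  have "\<forall>\<^sub>F k in sequentially. norm ((\<Delta> k)\<^sup>2) \<le> (P k - P (Suc k)) / a"
    using step const(2) by (auto simp: field_simps)
  then have "(\<lambda>k. (\<Delta> k)\<^sup>2) \<longlonglongrightarrow> 0"
    using lim0 by (rule Lim_null_comparison)
  then have "(\<lambda>k. sqrt ((\<Delta> k)\<^sup>2)) \<longlonglongrightarrow> sqrt 0" by (intro tendsto_intros)
  then have "\<Delta> \<longlonglongrightarrow> 0" by (simp add: \<Delta>_def[abs_def])
  then show thesis using that[of c fs] c step fs(2) fz unfolding P_def by blast
qed

text \<open>
  The shadow is at distance \<open>O(e)\<close> from the iterate, which is enough to control the subgradient. For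
  the values this first order bound would be too weak, because only the tails of the squared errors
  are known to have summable powers (see \<open>summable_steps\<close>). The third estimate is of second order: up to the small
  subgradient, the first order term is \<open>- n k \<bullet> (z (Suc k) - w k)\<close>, and testing \<open>opt\<close> with \<open>y = w k\<close>
  bounds it by \<open>C * (e (Suc k))\<^sup>2\<close>.
\<close>

lemma projection_estimates:
  obtains c where "0 \<le> c" "\<And>k. norm (w k - z (Suc k)) \<le> c * e (Suc k)"
    "\<And>k. norm (G (w k) + n k) \<le> c * (\<Delta> k + e (Suc k))"
    "\<And>k. f (z (Suc k)) \<le> f (w k) + c * ((\<Delta> k)\<^sup>2 + (e (Suc k))\<^sup>2)"
proof -
  obtain R where R: "0 \<le> R" "\<And>k. norm (n k) \<le> R" using obtain_bounds by metis
  define b where "b = sqrt (C + C * R)"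
  have b0: "0 \<le> C + C * R" using R const by simp
  then have b: "0 \<le> b" "b\<^sup>2 = C + C * R" by (simp_all add: b_def)
  have dist: "norm (w k - z (Suc k)) \<le> b * e (Suc k)" for k
  proof -
    obtain q where q: "q \<in> S" "norm (z (Suc k) - q) \<le> C * (e (Suc k))\<^sup>2" by (rule nearest)
    have "- (n k \<bullet> (w k - z (Suc k))) = n k \<bullet> (q - w k) + n k \<bullet> (z (Suc k) - q)"
      by (simp add: inner_diff_right)
    also have "n k \<bullet> (q - w k) \<le> 0" by (rule n_normal[OF q(1)])
    also have "n k \<bullet> (z (Suc k) - q) \<le> norm (n k) * norm (z (Suc k) - q)" by (rule norm_cauchy_schwarz)
    also have "\<dots> \<le> R * (C * (e (Suc k))\<^sup>2)" using R q by (intro mult_mono) auto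
    finally have 1: "- (n k \<bullet> (w k - z (Suc k))) \<le> C * R * (e (Suc k))\<^sup>2" by (simp add: mult_ac)
    have "(norm (w k - z (Suc k)))\<^sup>2 = (v k - n k) \<bullet> (w k - z (Suc k))"
      by (simp add: n_def power2_norm_eq_inner)
    also have "\<dots> = (w k - z (Suc k)) \<bullet> v k - n k \<bullet> (w k - z (Suc k))"
      by (simp add: inner_diff_left inner_commute)
    also have "\<dots> \<le> C * (e (Suc k))\<^sup>2 + C * R * (e (Suc k))\<^sup>2"
      using opt[OF w_in[of k], of k] 1 by linarith
    also have "\<dots> = (b * e (Suc k))\<^sup>2" by (simp add: power_mult_distrib b algebra_simps)
    finally show ?thesis by (rule power2_le_imp_le) (simp add: b(1) e(1))
  qed
  define c1 where "c1 = C + (\<Lambda> + 1) * b"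
  have c1: "0 \<le> c1" using const b by (simp add: c1_def)
  have sub: "norm (G (w k) + n k) \<le> c1 * (\<Delta> k + e (Suc k))" for k
  proof -
    have "G (w k) + n k = (v k + G (z (Suc k))) + (G (w k) - G (z (Suc k))) + (z (Suc k) - w k)"
      by (simp add: n_def)
    then have "norm (G (w k) + n k) \<le> norm (v k + G (z (Suc k))) + norm (G (w k) - G (z (Suc k)))
        + norm (w k - z (Suc k))"
      by (smt (verit) norm_minus_commute norm_triangle_ineq)
    also have "\<dots> \<le> C * \<Delta> k + \<Lambda> * norm (w k - z (Suc k)) + norm (w k - z (Suc k))"
      using res[of k] lipschitz[of "w k" "z (Suc k)"] w_in S(4) zB by (auto simp: \<Delta>_def intro!: add_mono)
    also have "\<dots> = C * \<Delta> k + (\<Lambda> + 1) * norm (w k - z (Suc k))" by (simp add: algebra_simps)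
    also have "\<dots> \<le> C * \<Delta> k + (\<Lambda> + 1) * (b * e (Suc k))"
      using dist const by (intro add_left_mono mult_left_mono) auto
    also have "\<dots> \<le> c1 * \<Delta> k + c1 * e (Suc k)"
      using const b e(1) unfolding c1_def
      by (intro add_mono) (auto simp: \<Delta>_def mult.assoc[symmetric] intro!: mult_right_mono)
    finally show ?thesis by (simp add: algebra_simps)
  qed
  define c2 where "c2 = 2 * c1 * b + C + \<Lambda> * b\<^sup>2"
  have c2: "0 \<le> c2" using c1 b(1) const by (simp add: c2_def)
  have val: "f (z (Suc k)) \<le> f (w k) + c2 * ((\<Delta> k)\<^sup>2 + (e (Suc k))\<^sup>2)" for k
  proof -
    let ?d = "z (Suc k) - w k"
    have nd: "norm ?d \<le> b * e (Suc k)" using dist[of k] by (simp add: norm_minus_commute)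
    have "- (n k \<bullet> ?d) = (w k - z (Suc k)) \<bullet> v k - (norm ?d)\<^sup>2"
      by (simp add: n_def power2_norm_eq_inner inner_diff_left inner_diff_right inner_add_left inner_add_right inner_commute)
    also have "\<dots> \<le> C * (e (Suc k))\<^sup>2"
      using opt[OF w_in[of k], of k] by (smt (verit) zero_le_power2)
    finally have 1: "- (n k \<bullet> ?d) \<le> C * (e (Suc k))\<^sup>2" .
    have "(G (w k) + n k) \<bullet> ?d \<le> norm (G (w k) + n k) * norm ?d" by (rule norm_cauchy_schwarz)
    also have "\<dots> \<le> (c1 * (\<Delta> k + e (Suc k))) * (b * e (Suc k))"
      using sub[of k] nd c1 e(1) by (intro mult_mono) (auto simp: \<Delta>_def)
    also have "\<dots> = c1 * b * (\<Delta> k * e (Suc k) + (e (Suc k))\<^sup>2)"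
      by (simp add: algebra_simps power2_eq_square)
    also have "\<dots> \<le> c1 * b * (2 * ((\<Delta> k)\<^sup>2 + (e (Suc k))\<^sup>2))"
    proof (rule mult_left_mono)
      have "2 * (\<Delta> k * e (Suc k)) \<le> (\<Delta> k)\<^sup>2 + (e (Suc k))\<^sup>2"
        using sum_squares_bound[of "\<Delta> k" "e (Suc k)"] by (simp only: mult.assoc)
      then show "\<Delta> k * e (Suc k) + (e (Suc k))\<^sup>2 \<le> 2 * ((\<Delta> k)\<^sup>2 + (e (Suc k))\<^sup>2)"
        using zero_le_power2[of "\<Delta> k"] zero_le_power2[of "e (Suc k)"] unfolding distrib_left by linarith
    qed (simp add: c1 b(1))
    finally have 2: "(G (w k) + n k) \<bullet> ?d \<le> 2 * c1 * b * ((\<Delta> k)\<^sup>2 + (e (Suc k))\<^sup>2)"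
      by (simp add: mult_ac)
    have 3: "\<Lambda> * (norm ?d)\<^sup>2 \<le> \<Lambda> * b\<^sup>2 * (e (Suc k))\<^sup>2"
      using power_mono[OF nd, of 2] const(1) mult_left_mono[of _ _ \<Lambda>]
      by (simp add: power_mult_distrib mult.assoc)
    have "f (z (Suc k)) \<le> f (w k) + G (w k) \<bullet> ?d + \<Lambda> * (norm ?d)\<^sup>2"
      using w_in S(4) zB by (intro f_upper) auto
    also have "\<dots> \<le> f (w k) + 2 * c1 * b * ((\<Delta> k)\<^sup>2 + (e (Suc k))\<^sup>2) + C * (e (Suc k))\<^sup>2
        + \<Lambda> * b\<^sup>2 * (e (Suc k))\<^sup>2"
      using 1 2 3 by (simp add: inner_add_left)
    also have "\<dots> \<le> f (w k) + 2 * c1 * b * ((\<Delta> k)\<^sup>2 + (e (Suc k))\<^sup>2) + C * ((\<Delta> k)\<^sup>2 + (e (Suc k))\<^sup>2)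
        + \<Lambda> * b\<^sup>2 * ((\<Delta> k)\<^sup>2 + (e (Suc k))\<^sup>2)"
      using const by (intro add_mono mult_left_mono order_refl) auto
    also have "\<dots> = f (w k) + c2 * ((\<Delta> k)\<^sup>2 + (e (Suc k))\<^sup>2)"
      by (simp add: c2_def algebra_simps)
    finally show ?thesis .
  qed
  define c where "c = b + c1 + c2"
  have le: "b \<le> c" "c1 \<le> c" "c2 \<le> c" using b c1 c2 by (auto simp: c_def)
  show thesis
  proof (rule that[of c])
    show "0 \<le> c" using b c1 c2 by (simp add: c_def)
    show "norm (w k - z (Suc k)) \<le> c * e (Suc k)" for k
      by (rule order_trans[OF dist]) (intro mult_right_mono le e)
    show "norm (G (w k) + n k) \<le> c * (\<Delta> k + e (Suc k))" for k
      by (rule order_trans[OF sub]) (intro mult_right_mono le, simp add: \<Delta>_def e)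
    show "f (z (Suc k)) \<le> f (w k) + c * ((\<Delta> k)\<^sup>2 + (e (Suc k))\<^sup>2)" for k
      by (rule order_trans[OF val]) (intro add_left_mono mult_right_mono le, simp)
  qed
qed

lemma value_at_projection_tendsto:
  assumes fz: "(\<lambda>k. f (z k)) \<longlonglongrightarrow> fs" and \<Delta>0: "\<Delta> \<longlonglongrightarrow> 0"
  shows "(\<lambda>k. f (w k)) \<longlonglongrightarrow> fs"
proof -
  obtain c where c: "0 \<le> c" "\<And>k. norm (w k - z (Suc k)) \<le> c * e (Suc k)"
    "\<And>k. f (z (Suc k)) \<le> f (w k) + c * ((\<Delta> k)\<^sup>2 + (e (Suc k))\<^sup>2)"
    using projection_estimates by metis
  obtain R where R: "0 \<le> R" "\<And>x. x \<in> B \<Longrightarrow> norm (G x) \<le> R"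
    using obtain_bounds by metis
  have e0: "(\<lambda>k. e (Suc k)) \<longlonglongrightarrow> 0" by (rule LIMSEQ_Suc[OF e_tendsto])
  have fz': "(\<lambda>k. f (z (Suc k))) \<longlonglongrightarrow> fs" by (rule LIMSEQ_Suc[OF fz])
  show ?thesis
  proof (rule tendsto_sandwich)
    show "\<forall>\<^sub>F k in sequentially. f (z (Suc k)) - c * ((\<Delta> k)\<^sup>2 + (e (Suc k))\<^sup>2) \<le> f (w k)"
      using c(3) by (intro always_eventually) (simp add: algebra_simps)
    show "\<forall>\<^sub>F k in sequentially.
        f (w k) \<le> f (z (Suc k)) + R * (c * e (Suc k)) + \<Lambda> * (c * e (Suc k))\<^sup>2"
    proof (intro always_eventually allI)
      fix k
      let ?d = "w k - z (Suc k)"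
      have "f (w k) \<le> f (z (Suc k)) + G (z (Suc k)) \<bullet> ?d + \<Lambda> * (norm ?d)\<^sup>2"
        using w_in S(4) zB by (intro f_upper) auto
      also have "G (z (Suc k)) \<bullet> ?d \<le> norm (G (z (Suc k))) * norm ?d" by (rule norm_cauchy_schwarz)
      also have "\<dots> \<le> R * (c * e (Suc k))" by (intro mult_mono R zB c) simp
      also have "\<Lambda> * (norm ?d)\<^sup>2 \<le> \<Lambda> * (c * e (Suc k))\<^sup>2"
        by (intro mult_left_mono power_mono c const) simp
      finally show "f (w k) \<le> f (z (Suc k)) + R * (c * e (Suc k)) + \<Lambda> * (c * e (Suc k))\<^sup>2"
        by simp
    qed
    have "(\<lambda>k. f (z (Suc k)) - c * ((\<Delta> k)\<^sup>2 + (e (Suc k))\<^sup>2)) \<longlonglongrightarrow> fs - c * (0\<^sup>2 + 0\<^sup>2)"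
      by (intro tendsto_intros fz' \<Delta>0 e0)
    then show "(\<lambda>k. f (z (Suc k)) - c * ((\<Delta> k)\<^sup>2 + (e (Suc k))\<^sup>2)) \<longlonglongrightarrow> fs" by simp
    have "(\<lambda>k. f (z (Suc k)) + R * (c * e (Suc k)) + \<Lambda> * (c * e (Suc k))\<^sup>2)
        \<longlonglongrightarrow> fs + R * (c * 0) + \<Lambda> * (c * 0)\<^sup>2"
      by (intro tendsto_intros fz' e0)
    then show "(\<lambda>k. f (z (Suc k)) + R * (c * e (Suc k)) + \<Lambda> * (c * e (Suc k))\<^sup>2) \<longlonglongrightarrow> fs"
      by simp
  qed
qed

lemma subgradient_tendsto:
  assumes \<Delta>0: "\<Delta> \<longlonglongrightarrow> 0"
  shows "(\<lambda>k. G (w k) + n k) \<longlonglongrightarrow> 0"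
proof -
  obtain c where c: "\<And>k. norm (G (w k) + n k) \<le> c * (\<Delta> k + e (Suc k))"
    using projection_estimates by metis
  have "(\<lambda>k. c * (\<Delta> k + e (Suc k))) \<longlonglongrightarrow> c * (0 + 0)"
    by (intro tendsto_intros \<Delta>0 LIMSEQ_Suc[OF e_tendsto])
  then have "(\<lambda>k. c * (\<Delta> k + e (Suc k))) \<longlonglongrightarrow> 0" by simp
  then show ?thesis
    by (rule Lim_null_comparison[rotated]) (intro always_eventually allI c)
qed

text \<open>
  By the estimates on the shadows, the energy \<open>H\<close> above its limit satisfies
  \<open>H (Suc k) powr \<theta> \<le> c6 * (\<Delta> k + s k)\<close> with a summable \<open>s\<close>. The Lojasiewicz exponent is first raised
  to at least \<open>1/2\<close>, so that \<open>(\<Delta> k)\<^sup>2 powr \<theta>\<close> is at most \<open>\<Delta> k\<close>, and to at least \<open>\<theta>b\<close>, so that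
  \<open>E (Suc k) powr \<theta>\<close> is dominated by a summable sequence.
\<close>

lemma summable_steps:
  assumes loj: "\<And>x. stationary (constrained f S) x \<Longrightarrow> lojasiewicz_at (constrained f S) x"
    and \<theta>b: "0 < \<theta>b" "\<theta>b < 1" and tail: "summable (\<lambda>k. E k powr \<theta>b)"
  shows "summable \<Delta>"
proof -
  obtain c1 fs where c1: "0 \<le> c1"
    and step: "\<And>k. a * (\<Delta> k)\<^sup>2 \<le> (f (z k) + c1 * (E k + E (Suc k)))
      - (f (z (Suc k)) + c1 * (E (Suc k) + E (Suc (Suc k))))"
    and lower: "\<And>k. fs \<le> f (z k) + c1 * (E k + E (Suc k))"
    and fz: "(\<lambda>k. f (z k)) \<longlonglongrightarrow> fs" and \<Delta>0: "\<Delta> \<longlonglongrightarrow> 0"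
    by (rule energy) blast
  obtain c2 where c2: "0 \<le> c2"
    and sub: "\<And>k. norm (G (w k) + n k) \<le> c2 * (\<Delta> k + e (Suc k))"
    and val: "\<And>k. f (z (Suc k)) \<le> f (w k) + c2 * ((\<Delta> k)\<^sup>2 + (e (Suc k))\<^sup>2)"
    by (rule projection_estimates) blast
  have GS: "continuous_on S G" by (rule continuous_on_subset[OF G_cont S(4)])
  obtain \<theta> c3 where \<theta>: "max (1/2) \<theta>b \<le> \<theta>" "\<theta> < 1" and c3: "0 < c3"
    and kl: "\<forall>\<^sub>F k in sequentially. \<bar>f (w k) - fs\<bar> powr \<theta> \<le> c3 * norm (G (w k) + n k)"
    by (rule lojasiewicz_along_sequence[OF S(2) w_in f' GS n_normal subgradient_tendsto[OF \<Delta>0]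
          value_at_projection_tendsto[OF fz \<Delta>0] loj, of "max (1/2) \<theta>b"]) (use \<theta>b in auto)
  have \<theta>': "1/2 \<le> \<theta>" "\<theta>b \<le> \<theta>" "0 < \<theta>" using \<theta> by auto
  have "\<forall>\<^sub>F k in sequentially. \<Delta> k < 1" using order_tendstoD(2)[OF \<Delta>0] by simp
  moreover have "\<forall>\<^sub>F k in sequentially. E (Suc k) < 1"
    using order_tendstoD(2)[OF LIMSEQ_Suc[OF E_tendsto]] by simp
  ultimately have "\<forall>\<^sub>F k in sequentially. \<Delta> k < 1 \<and> E (Suc k) < 1
      \<and> \<bar>f (w k) - fs\<bar> powr \<theta> \<le> c3 * norm (G (w k) + n k)"
    using kl by eventually_elim simp
  then obtain K where K: "\<And>k. K \<le> k \<Longrightarrow> \<Delta> k < 1" "\<And>k. K \<le> k \<Longrightarrow> E (Suc k) < 1"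
    "\<And>k. K \<le> k \<Longrightarrow> \<bar>f (w k) - fs\<bar> powr \<theta> \<le> c3 * norm (G (w k) + n k)"
    unfolding eventually_sequentially by blast
  define H where "H k = f (z k) + c1 * (E k + E (Suc k)) - fs" for k
  define s where "s k = e (Suc k) + E (Suc k) powr \<theta>b" for k
  define c5 where "c5 = c2 + 2 * c1"
  \<comment> \<open>the coefficients of \<open>\<Delta> k + s k\<close> that arise below, increased by 1 to be positive\<close>
  define c6 where "c6 = 3 * (c3 * c2 + c2 powr \<theta> + c5 powr \<theta>) + 1"
  have c5: "0 \<le> c5" using c1 c2 by (simp add: c5_def)
  have c6: "0 < c6" using c3 c2 by (simp add: c6_def add_nonneg_pos)
  have H0: "0 \<le> H k" for k using lower[of k] by (simp add: H_def)
  have \<Delta>nn: "0 \<le> \<Delta> k" for k by (simp add: \<Delta>_def)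
  have main: "H (Suc k) powr \<theta> \<le> c6 * (\<Delta> k + s k)" if k: "K \<le> k" for k
  proof -
    have Ek: "(e (Suc k))\<^sup>2 \<le> E (Suc k)" "E (Suc (Suc k)) \<le> E (Suc k)"
      using E_Suc[of "Suc k"] E_nonneg[of "Suc (Suc k)"] by auto
    have "H (Suc k) \<le> (f (w k) - fs) + c2 * ((\<Delta> k)\<^sup>2 + (e (Suc k))\<^sup>2) + c1 * (E (Suc k) + E (Suc (Suc k)))"
      using val[of k] by (simp add: H_def)
    also have "\<dots> \<le> \<bar>f (w k) - fs\<bar> + c2 * ((\<Delta> k)\<^sup>2 + E (Suc k)) + c1 * (E (Suc k) + E (Suc k))"
      using Ek c1 c2 by (intro add_mono mult_left_mono) auto
    also have "\<dots> = \<bar>f (w k) - fs\<bar> + c2 * (\<Delta> k)\<^sup>2 + c5 * E (Suc k)"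
      by (simp add: c5_def algebra_simps)
    finally have "H (Suc k) powr \<theta> \<le> (\<bar>f (w k) - fs\<bar> + c2 * (\<Delta> k)\<^sup>2 + c5 * E (Suc k)) powr \<theta>"
      using H0 \<theta>' by (intro powr_mono2) auto
    also have "\<dots> \<le> 3 * (\<bar>f (w k) - fs\<bar> powr \<theta> + (c2 * (\<Delta> k)\<^sup>2) powr \<theta> + (c5 * E (Suc k)) powr \<theta>)"
      using c2 c5 E_nonneg \<theta> \<theta>' by (intro powr_sum3_le) auto
    also have "\<bar>f (w k) - fs\<bar> powr \<theta> \<le> c3 * (c2 * (\<Delta> k + e (Suc k)))"
      by (rule order_trans[OF K(3)[OF k]]) (use c3 sub[of k] in \<open>simp add: mult_left_mono\<close>)
    also have "(c2 * (\<Delta> k)\<^sup>2) powr \<theta> \<le> c2 powr \<theta> * \<Delta> k"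
    proof -
      have "((\<Delta> k)\<^sup>2) powr \<theta> \<le> ((\<Delta> k)\<^sup>2) powr (1/2)"
        using \<theta>' K(1)[OF k] \<Delta>nn[of k] by (intro powr_mono') (auto simp: power_le_one)
      also have "\<dots> = \<Delta> k" using \<Delta>nn[of k] by (simp add: powr_half_sqrt)
      finally show ?thesis using c2 by (simp add: powr_mult mult_left_mono)
    qed
    also have "(c5 * E (Suc k)) powr \<theta> \<le> c5 powr \<theta> * E (Suc k) powr \<theta>b"
    proof -
      have "E (Suc k) powr \<theta> \<le> E (Suc k) powr \<theta>b"
        using \<theta>' K(2)[OF k] E_nonneg by (intro powr_mono') auto
      then show ?thesis using c5 E_nonneg by (simp add: powr_mult mult_left_mono)
    qed
    also have "3 * (c3 * (c2 * (\<Delta> k + e (Suc k))) + c2 powr \<theta> * \<Delta> k + c5 powr \<theta> * E (Suc k) powr \<theta>b)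
        \<le> 3 * (c3 * c2 * (\<Delta> k + s k) + c2 powr \<theta> * (\<Delta> k + s k) + c5 powr \<theta> * (\<Delta> k + s k))"
      using c2 c3 \<Delta>nn[of k] e(1)
      by (simp only: mult.assoc[symmetric])
        (intro mult_left_mono add_mono, auto simp: s_def)
    also have "\<dots> = (c6 - 1) * (\<Delta> k + s k)"
      by (simp add: c6_def algebra_simps)
    also have "\<dots> \<le> c6 * (\<Delta> k + s k)"
      using \<Delta>nn[of k] e(1) by (intro mult_right_mono) (auto simp: s_def)
    finally show ?thesis by simp
  qed
  have s: "summable s"
    unfolding s_def using e(2) tail
    by (intro summable_add) (simp_all add: summable_Suc_iff[of e] summable_Suc_iff[of "\<lambda>k. E k powr \<theta>b"])
  have "summable (\<lambda>j. \<Delta> (j + K))"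
  proof (rule summable_steps_if_powr_decrease[where H = "\<lambda>j. H (j + K)" and s = "\<lambda>j. s (j + K)"
        and a = a and C = c6 and \<theta> = \<theta>])
    show "summable (\<lambda>j. s (j + K))" using s by (simp add: summable_iff_shift)
    show "0 \<le> s (j + K)" for j using e(1) by (simp add: s_def)
    show "a * (\<Delta> (j + K))\<^sup>2 \<le> H (j + K) - H (Suc j + K)" for j
      using step[of "j + K"] by (simp add: H_def)
    show "H (Suc j + K) powr \<theta> \<le> c6 * (\<Delta> (j + K) + s (j + K))" for j
      using main[of "j + K"] by simp
  qed (use const c6 \<theta> \<theta>' H0 \<Delta>nn in auto)
  then show ?thesis by (simp add: summable_iff_shift)
qed

theorem converges_to_stationary:
  assumes loj: "\<And>x. stationary (constrained f S) x \<Longrightarrow> lojasiewicz_at (constrained f S) x"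
    and \<theta>b: "0 < \<theta>b" "\<theta>b < 1" and tail: "summable (\<lambda>k. E k powr \<theta>b)"
  shows "\<exists>zs. z \<longlonglongrightarrow> zs \<and> stationary (constrained f S) zs"
proof -
  have sum\<Delta>: "summable \<Delta>" by (rule summable_steps[OF assms])
  then have "summable (\<lambda>k. norm (z (Suc k) - z k))" by (simp add: \<Delta>_def[abs_def])
  then have "summable (\<lambda>k. z (Suc k) - z k)" by (rule summable_norm_cancel)
  then have "(\<lambda>N. \<Sum>k<N. z (Suc k) - z k) \<longlonglongrightarrow> (\<Sum>k. z (Suc k) - z k)"
    by (rule summable_LIMSEQ)
  then have "(\<lambda>N. z N - z 0) \<longlonglongrightarrow> (\<Sum>k. z (Suc k) - z k)"
    by (simp add: sum_lessThan_telescope)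
  from tendsto_add[OF this tendsto_const[of "z 0"]] obtain zs where zs: "z \<longlonglongrightarrow> zs" by auto
  obtain c where c: "\<And>k. norm (w k - z (Suc k)) \<le> c * e (Suc k)"
    using projection_estimates by metis
  have "(\<lambda>k. c * e (Suc k)) \<longlonglongrightarrow> c * 0" by (intro tendsto_intros LIMSEQ_Suc[OF e_tendsto])
  then have "(\<lambda>k. c * e (Suc k)) \<longlonglongrightarrow> 0" by simp
  then have "(\<lambda>k. w k - z (Suc k)) \<longlonglongrightarrow> 0"
    by (rule Lim_null_comparison[rotated]) (intro always_eventually allI c)
  from tendsto_add[OF this LIMSEQ_Suc[OF zs]] have wl: "w \<longlonglongrightarrow> zs" by simp
  have "zs \<in> S" by (rule closed_sequentially[OF closed_S w_in wl])
  then have Gc: "continuous (at zs within S) G"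
    using continuous_on_subset[OF G_cont S(4)] by (simp add: continuous_on_eq_continuous_within)
  have "stationary (constrained f S) zs"
    by (rule stationary_limit_of_projections[OF closed_S w_in wl f' Gc n_normal
          subgradient_tendsto[OF summable_LIMSEQ_zero[OF sum\<Delta>]]])
  with zs show ?thesis by blast
qed

end

section \<open>Convex and affine inequality systems\<close>

text \<open>
  Slightly infeasible points of a convex system with compact solution set are close to that set.
  Otherwise there are points \<open>w k\<close> at distance more than \<open>\<delta>\<close> whose violation tends to 0. Moving each
  towards its projection \<open>q k\<close> until the distance is exactly \<open>\<delta>\<close> keeps the violation small by
  convexity and makes the points bounded; a cluster point is feasible and at distance at least \<open>\<delta>\<close> from \<open>S\<close>.
\<close>

lemma convex_sublevel_near:
  fixes g :: "'j \<Rightarrow> 'a::euclidean_space \<Rightarrow> real"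
  assumes V: "convex V" "closed V"
    and g: "\<And>j. j \<in> J \<Longrightarrow> convex_on V (g j)" "\<And>j. j \<in> J \<Longrightarrow> continuous_on V (g j)"
    and S: "S = {w \<in> V. \<forall>j\<in>J. g j w \<le> 0}" "compact S" "S \<noteq> {}" and \<delta>: "0 < \<delta>"
  obtains m where "0 < m" "\<And>w. w \<in> V \<Longrightarrow> (\<And>j. j \<in> J \<Longrightarrow> g j w \<le> m) \<Longrightarrow> \<exists>q\<in>S. norm (w - q) \<le> \<delta>"
proof (rule ccontr)
  assume neg: "\<not> thesis"
  have "\<exists>w\<in>V. (\<forall>j\<in>J. g j w \<le> 1 / real (Suc k)) \<and> (\<forall>q\<in>S. \<delta> < norm (w - q))" for k
    using neg that[of "1 / real (Suc k)"] by (fastforce simp: not_le)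
  then obtain w where w: "\<And>k. w k \<in> V" "\<And>k j. j \<in> J \<Longrightarrow> g j (w k) \<le> 1 / real (Suc k)"
    "\<And>k q. q \<in> S \<Longrightarrow> \<delta> < norm (w k - q)"
    by metis
  have clS: "closed S" by (rule compact_imp_closed[OF S(2)])
  define q where "q k = closest_point S (w k)" for k
  define t where "t k = \<delta> / norm (w k - q k)" for k
  define y where "y k = (1 - t k) *\<^sub>R q k + t k *\<^sub>R w k" for k
  have q: "q k \<in> S" for k unfolding q_def by (rule closest_point_in_set[OF clS S(3)])
  have qV: "q k \<in> V" for k using q S(1) by auto
  have t: "0 < t k" "t k < 1" for k
    using w(3)[OF q] \<delta> by (auto simp: t_def divide_less_eq_1) (smt (verit) divide_pos_pos w(3) q)+
  have tn: "t k * norm (w k - q k) = \<delta>" for k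
    using w(3)[OF q[of k], of k] \<delta> by (auto simp: t_def)
  have yV: "y k \<in> V" for k
    using convexD_alt[OF V(1) qV[of k] w(1)[of k], of "t k"] t[of k] by (simp add: y_def)
  have gy: "g j (y k) \<le> 1 / real (Suc k)" if j: "j \<in> J" for j k
  proof -
    have "g j (y k) \<le> (1 - t k) * g j (q k) + t k * g j (w k)"
      unfolding y_def using t[of k] qV w(1) by (intro convex_onD[OF g(1)[OF j]]) auto
    also have "\<dots> \<le> (1 - t k) * 0 + 1 * (1 / real (Suc k))"
    proof (intro add_mono)
      show "(1 - t k) * g j (q k) \<le> (1 - t k) * 0"
        using q[of k] S(1) j t[of k] by (intro mult_left_mono) auto
      have "t k * g j (w k) \<le> t k * (1 / real (Suc k))"
        using w(2)[OF j] t[of k] by (intro mult_left_mono) auto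
      also have "\<dots> \<le> 1 * (1 / real (Suc k))" using t[of k] by (intro mult_right_mono) auto
      finally show "t k * g j (w k) \<le> 1 * (1 / real (Suc k))" .
    qed
    finally show ?thesis by simp
  qed
  have far: "\<delta> \<le> norm (y k - s)" if "s \<in> S" for s k
  proof -
    have "w k - y k = (1 - t k) *\<^sub>R (w k - q k)" by (simp add: y_def algebra_simps)
    then have "norm (w k - y k) = (1 - t k) * norm (w k - q k)" using t[of k] by simp
    also have "\<dots> = norm (w k - q k) - \<delta>" using tn[of k] by (simp add: algebra_simps)
    also have "norm (w k - q k) \<le> norm (w k - s)"
      using closest_point_le[OF clS that] by (simp add: q_def dist_norm)
    finally show ?thesis using norm_triangle_ineq[of "w k - y k" "y k - s"] by simp
  qed
  have "bounded (range y)"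
  proof -
    obtain R where R: "\<And>s. s \<in> S \<Longrightarrow> norm s \<le> R"
      using compact_imp_bounded[OF S(2)] unfolding bounded_iff by blast
    have "norm (y k) \<le> R + \<delta>" for k
    proof -
      have "y k = q k + t k *\<^sub>R (w k - q k)" by (simp add: y_def algebra_simps)
      then have "norm (y k) \<le> norm (q k) + norm (t k *\<^sub>R (w k - q k))" using norm_triangle_ineq by metis
      also have "norm (t k *\<^sub>R (w k - q k)) = \<delta>" using tn[of k] t(1)[of k] by simp
      finally show ?thesis using R[OF q[of k]] by linarith
    qed
    then show ?thesis unfolding bounded_iff by auto
  qed
  then obtain l r where r: "strict_mono r" and l: "(\<lambda>k. y (r k)) \<longlonglongrightarrow> l"
    using bounded_imp_convergent_subsequence unfolding comp_def by metis
  have lV: "l \<in> V" by (rule closed_sequentially[OF V(2) yV l])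
  have "l \<in> S"
    unfolding S(1)
  proof (intro CollectI conjI ballI lV)
    fix j assume j: "j \<in> J"
    have "continuous (at l within V) (g j)"
      using g(2)[OF j] lV by (simp add: continuous_on_eq_continuous_within)
    from continuous_within_tendsto_compose'[OF this yV l]
    have lim: "(\<lambda>k. g j (y (r k))) \<longlonglongrightarrow> g j l" .
    have "(\<lambda>k. 1 / real (Suc (r k))) \<longlonglongrightarrow> 0"
      using filterlim_compose[OF LIMSEQ_Suc[OF lim_1_over_n] filterlim_subseq[OF r]] by simp
    then show "g j l \<le> 0" using lim gy[OF j] by (intro LIMSEQ_le[OF lim]) auto
  qed
  have "(\<lambda>k. norm (y (r k) - l)) \<longlonglongrightarrow> norm (l - l)" by (intro tendsto_intros l)
  then have "\<delta> \<le> norm (l - l)" by (rule LIMSEQ_le_const) (use far[OF \<open>l \<in> S\<close>] in auto)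
  then show False using \<delta> by simp
qed

text \<open>
  A finite affine system that can be solved up to every positive error is solvable, although the
  approximate solutions may be unbounded. This is Farkas' lemma: the cone \<open>K\<close> generated by the
  coefficient vectors \<open>(a j, c j)\<close> is closed because it is finitely generated. If it misses \<open>(0, 1)\<close>, a
  separating hyperplane yields a solution. If it contains \<open>(0, 1)\<close>, a nonnegative combination
  of the inequalities reads \<open>1 \<le> C * m\<close> for all \<open>m > 0\<close>.
\<close>

lemma affine_system_feasible:
  fixes a :: "'j \<Rightarrow> 'a::euclidean_space" and c :: "'j \<Rightarrow> real"
  assumes J: "finite J" and approx: "\<And>m. 0 < m \<Longrightarrow> \<exists>w. \<forall>j\<in>J. a j \<bullet> w + c j \<le> m"
  shows "\<exists>w. \<forall>j\<in>J. a j \<bullet> w + c j \<le> 0"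
proof -
  define K where "K = convex_cone hull ((\<lambda>j. (a j, c j)) ` J)"
  have K0: "0 \<in> K" unfolding K_def by (rule convex_cone_hull_contains_0)
  have Kmul: "r *\<^sub>R x \<in> K" if "x \<in> K" "0 \<le> r" for r x
    using that unfolding K_def by (intro convex_cone_hull_mul)
  have Kj: "(a j, c j) \<in> K" if "j \<in> J" for j
    unfolding K_def using that by (intro hull_inc) auto
  have "(0, 1) \<notin> K"
  proof
    assume in_K: "(0, 1) \<in> K"
    \<comment> \<open>the linear functionals that are bounded by a fixed multiple of the error\<close>
    define T where "T = {x. \<exists>C\<ge>0. \<forall>m w. 0 < m \<longrightarrow> (\<forall>j\<in>J. a j \<bullet> w + c j \<le> m) \<longrightarrow> fst x \<bullet> w + snd x \<le> C * m}"
    have "K \<subseteq> T"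
      unfolding K_def
    proof (rule hull_minimal)
      show "(\<lambda>j. (a j, c j)) ` J \<subseteq> T"
        unfolding T_def by (auto intro!: exI[of _ "1::real"])
      show "convex_cone T"
        unfolding convex_cone_iff
      proof (intro conjI ballI allI impI)
        show "0 \<in> T" unfolding T_def by (auto intro!: exI[of _ "0::real"])
      next
        fix x y assume "x \<in> T" "y \<in> T"
        then obtain A B where AB: "0 \<le> A" "0 \<le> B"
          and le: "\<And>m w. 0 < m \<Longrightarrow> (\<forall>j\<in>J. a j \<bullet> w + c j \<le> m) \<Longrightarrow> fst x \<bullet> w + snd x \<le> A * m"
            "\<And>m w. 0 < m \<Longrightarrow> (\<forall>j\<in>J. a j \<bullet> w + c j \<le> m) \<Longrightarrow> fst y \<bullet> w + snd y \<le> B * m"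
          unfolding T_def by blast
        have "fst (x + y) \<bullet> w + snd (x + y) \<le> (A + B) * m"
          if "0 < m" "\<forall>j\<in>J. a j \<bullet> w + c j \<le> m" for m w
          using add_mono[OF le[OF that]] by (simp add: algebra_simps)
        then show "x + y \<in> T"
          unfolding T_def using AB by (blast intro: add_nonneg_nonneg)
      next
        fix x and r :: real assume "x \<in> T" and r: "0 \<le> r"
        then obtain A where A: "0 \<le> A"
          and le: "\<And>m w. 0 < m \<Longrightarrow> (\<forall>j\<in>J. a j \<bullet> w + c j \<le> m) \<Longrightarrow> fst x \<bullet> w + snd x \<le> A * m"
          unfolding T_def by blast
        have "fst (r *\<^sub>R x) \<bullet> w + snd (r *\<^sub>R x) \<le> (r * A) * m"
          if "0 < m" "\<forall>j\<in>J. a j \<bullet> w + c j \<le> m" for m w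
          using mult_left_mono[OF le[OF that] r] by (simp add: algebra_simps)
        then show "r *\<^sub>R x \<in> T"
          unfolding T_def using A r by (blast intro: mult_nonneg_nonneg)
      qed
    qed
    then have "(0, 1) \<in> T" using in_K by blast
    then obtain C where C: "0 \<le> C"
      "\<And>m w. 0 < m \<Longrightarrow> (\<forall>j\<in>J. a j \<bullet> w + c j \<le> m) \<Longrightarrow> (0::'a) \<bullet> w + 1 \<le> C * m"
      unfolding T_def by auto
    define m where "m = 1 / (2 * (C + 1))"
    have m: "0 < m" "C * m < 1" using C(1) by (auto simp: m_def field_simps)
    then show False using approx[OF m(1)] C(2)[OF m(1)] by force
  qed
  moreover have "closed K" "convex K"
    unfolding K_def using J by (auto intro: closed_convex_cone_hull convex_convex_cone_hull)
  ultimately obtain u b where u: "u \<bullet> (0, 1) < b" "\<And>x. x \<in> K \<Longrightarrow> b < u \<bullet> x"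
    using separating_hyperplane_closed_point[of K "(0, 1)"] by blast
  obtain v s where vs: "u = (v, s)" by (cases u)
  have b: "b < 0" using u(2)[OF K0] by simp
  then have s: "s < 0" using u(1) by (simp add: vs)
  have nonneg: "0 \<le> u \<bullet> x" if "x \<in> K" for x
  proof (rule ccontr)
    assume neg: "\<not> 0 \<le> u \<bullet> x"
    have "b < u \<bullet> ((b / (u \<bullet> x)) *\<^sub>R x)"
      using b neg by (intro u(2) Kmul that) (auto simp: divide_nonpos_neg)
    then show False using neg by simp
  qed
  have "a j \<bullet> ((1 / s) *\<^sub>R v) + c j \<le> 0" if "j \<in> J" for j
    using nonneg[OF Kj[OF that]] s by (simp add: vs field_simps inner_commute)
  then show ?thesis by blast
qed

section \<open>Products of coordinate blocks\<close>

lemma bproj_component: "bproj blk i z $ d = (if blk d = i then z $ d else 0)"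
  by (simp add: bproj_def)

lemma linear_bproj: "linear (bproj blk i)"
  by (intro linearI) (simp_all add: vec_eq_iff bproj_component)

lemmas bproj_diff = linear_diff[OF linear_bproj]
  and bproj_add = linear_add[OF linear_bproj]

lemma subspace_bspace: "subspace (bspace blk i)"
  by (auto simp: bspace_def subspace_def)

lemma bproj_in_bspace: "bproj blk i z \<in> bspace blk i"
  by (simp add: bspace_def bproj_component)

lemma bproj_of_bspace: "w \<in> bspace blk i \<Longrightarrow> bproj blk i w = w"
  by (auto simp: bspace_def bproj_component vec_eq_iff)

lemma inner_bproj: "bproj blk i x \<bullet> y = x \<bullet> bproj blk i y"
  by (auto simp: inner_vec_def bproj_component intro!: sum.cong)

lemma norm_bproj_le: "norm (bproj blk i x) \<le> norm x"
  by (rule norm_le_componentwise_cart) (simp add: bproj_component)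

lemma sum_bproj:
  assumes "range blk = {1..n}"
  shows "(\<Sum>i=1..n. bproj blk i x) = x"
proof -
  have "(\<Sum>i=1..n. bproj blk i x $ d) = x $ d" for d
    using assms by (auto simp: bproj_component)
  then show ?thesis by (simp add: vec_eq_iff)
qed

lemma inner_eq_sum_blocks:
  assumes "range blk = {1..n}"
  shows "x \<bullet> y = (\<Sum>i=1..n. bproj blk i x \<bullet> bproj blk i y)"
proof -
  have "x \<bullet> y = (\<Sum>i=1..n. bproj blk i x) \<bullet> y" by (simp only: sum_bproj[OF assms])
  also have "\<dots> = (\<Sum>i=1..n. bproj blk i x \<bullet> y)" by (rule inner_sum_left)
  also have "\<dots> = (\<Sum>i=1..n. bproj blk i x \<bullet> bproj blk i y)"
    by (simp only: inner_bproj[symmetric] bproj_of_bspace[OF bproj_in_bspace])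
  finally show ?thesis .
qed

lemma norm_le_sum_blocks:
  assumes "range blk = {1..n}"
  shows "norm x \<le> (\<Sum>i=1..n. norm (bproj blk i x))"
  using norm_sum[of "\<lambda>i. bproj blk i x" "{1..n}"] by (simp only: sum_bproj[OF assms])

lemma norm_le_of_blocks:
  assumes "range blk = {1..n}" and "\<And>i. i \<in> {1..n} \<Longrightarrow> norm (bproj blk i x) \<le> c"
  shows "norm x \<le> real n * c"
  by (rule order_trans[OF norm_le_sum_blocks[OF assms(1)]])
    (use sum_bounded_above[of "{1..n}" "\<lambda>i. norm (bproj blk i x)" c] assms(2) in simp)

text \<open>
  Points chosen independently in the blocks are the blocks of a single point. Through this lemma
  projections onto product sets are assembled from those onto the factors.
\<close>

lemma blockwise_choice:
  assumes blocks: "range blk = {1..n}" and ex: "\<And>i. i \<in> {1..n} \<Longrightarrow> \<exists>q\<in>bspace blk i. Q i q"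
  obtains q where "\<And>i. i \<in> {1..n} \<Longrightarrow> Q i (bproj blk i q)"
proof -
  obtain u where u: "\<And>i. i \<in> {1..n} \<Longrightarrow> u i \<in> bspace blk i \<and> Q i (u i)"
    using ex by metis
  have "bproj blk i (\<chi> d. u (blk d) $ d) = u i" if "i \<in> {1..n}" for i
    using u[OF that] by (auto simp: vec_eq_iff bproj_component bspace_def)
  then show thesis using that[of "\<chi> d. u (blk d) $ d"] u by metis
qed

lemma mixed_one:
  assumes "range blk = {1..n}" shows "mixed blk 1 z' z = z"
proof -
  have "\<not> blk d < 1" for d using assms by (metis atLeastAtMost_iff not_less rangeI)
  then show ?thesis by (simp only: mixed_def vec_eq_iff vec_lambda_beta if_False simp_thms)
qed

lemma mixed_last:
  assumes "range blk = {1..n}" shows "mixed blk (Suc n) z' z = z'"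
proof -
  have "blk d < Suc n" for d using assms by (metis atLeastAtMost_iff less_Suc_eq_le rangeI)
  then show ?thesis by (simp only: mixed_def vec_eq_iff vec_lambda_beta if_True simp_thms)
qed

lemma mixed_Suc: "mixed blk (Suc i) z' z = mixed blk i z' z + bproj blk i (z' - z)"
  by (auto simp: mixed_def vec_eq_iff bproj_component less_Suc_eq)

lemma norm_mixed_le: "norm (z' - mixed blk i z' z) \<le> norm (z' - z)"
  by (rule norm_le_componentwise_cart) (simp add: mixed_def)

lemma mixed_in_bprod:
  assumes "z \<in> bprod blk n A" "z' \<in> bprod blk n A"
  shows "mixed blk i z' z \<in> bprod blk n A"
proof -
  have "bproj blk j (mixed blk i z' z) = (if j < i then bproj blk j z' else bproj blk j z)" for j
    by (auto simp: mixed_def vec_eq_iff bproj_component)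
  then show ?thesis using assms by (auto simp: bprod_def)
qed

lemma convex_bprod:
  assumes "\<And>i. i \<in> {1..n} \<Longrightarrow> convex (A i)" shows "convex (bprod blk n A)"
proof -
  have "bprod blk n A = (\<Inter>i\<in>{1..n}. bproj blk i -` A i)" by (auto simp: bprod_def)
  then show ?thesis using assms by (auto intro!: convex_INT convex_linear_vimage linear_bproj)
qed

lemma closed_bprod:
  assumes "\<And>i. i \<in> {1..n} \<Longrightarrow> closed (A i)" shows "closed (bprod blk n A)"
proof -
  have "bprod blk n A = (\<Inter>i\<in>{1..n}. bproj blk i -` A i)" by (auto simp: bprod_def)
  moreover have "closed (bproj blk i -` A i)" if "i \<in> {1..n}" for i
    using assms[OF that]
    by (rule continuous_closed_vimage)
      (rule linear_continuous_at[OF linear_conv_bounded_linear[THEN iffD1, OF linear_bproj]])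
  ultimately show ?thesis by auto
qed

lemma bounded_bprod:
  assumes blocks: "range blk = {1..n}" and A: "\<And>i. i \<in> {1..n} \<Longrightarrow> bounded (A i)"
  shows "bounded (bprod blk n A)"
proof -
  have "bounded (\<Union>i\<in>{1..n}. A i)" using A by (intro bounded_UN) auto
  then obtain R where R: "\<And>i w. i \<in> {1..n} \<Longrightarrow> w \<in> A i \<Longrightarrow> norm w \<le> R"
    unfolding bounded_iff by blast
  have "norm x \<le> real n * R" if "x \<in> bprod blk n A" for x
    using that by (intro norm_le_of_blocks[OF blocks] R) (auto simp: bprod_def)
  then show ?thesis unfolding bounded_iff by blast
qed

lemma objective_eq: "objective blk n p h f = (\<lambda>x. ereal (f x) + delta_ind (bprod blk n (feas blk p h)) x)"
proof
  fix x
  have "(\<Sum>i=1..n. delta_ind (feas blk p h i) (bproj blk i x)) = delta_ind (bprod blk n (feas blk p h)) x"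
  proof (cases "x \<in> bprod blk n (feas blk p h)")
    case True
    then show ?thesis by (auto simp: bprod_def delta_ind_def intro!: sum.neutral)
  next
    case False
    then obtain i where "i \<in> {1..n}" "bproj blk i x \<notin> feas blk p h i" by (auto simp: bprod_def)
    then have "\<exists>i\<in>{1..n}. delta_ind (feas blk p h i) (bproj blk i x) = \<infinity>"
      by (auto simp: delta_ind_def)
    then have "(\<Sum>i=1..n. delta_ind (feas blk p h i) (bproj blk i x)) = \<infinity>"
      by (simp only: sum_Pinfty finite_atLeastAtMost simp_thms)
    then show ?thesis using False by (simp add: delta_ind_def)
  qed
  then show "objective blk n p h f x = ereal (f x) + delta_ind (bprod blk n (feas blk p h)) x"
    by (simp add: objective_def)
qed

lemma edist_set_le_iff:
  fixes A :: "'a::euclidean_space set"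
  assumes A: "closed A" "A \<noteq> {}"
  shows "edist_set w A \<le> ereal c \<longleftrightarrow> (\<exists>q\<in>A. norm (w - q) \<le> c)"
proof
  assume le: "edist_set w A \<le> ereal c"
  have "ereal (norm (w - closest_point A w)) \<le> edist_set w A"
    unfolding edist_set_def
    by (rule INF_greatest) (use closest_point_le[OF A(1)] in \<open>simp add: dist_norm\<close>)
  then have "ereal (norm (w - closest_point A w)) \<le> ereal c" using le by (rule order_trans)
  then show "\<exists>q\<in>A. norm (w - q) \<le> c"
    using closest_point_in_set[OF A] by auto
next
  assume "\<exists>q\<in>A. norm (w - q) \<le> c"
  then show "edist_set w A \<le> ereal c" unfolding edist_set_def by (auto intro!: INF_lower2)
qed

lemma grad_on_bspace:
  assumes g: "g differentiable_on bspace blk i" and x: "x \<in> bspace blk i"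
  shows "(g has_derivative (\<lambda>v. grad_on (bspace blk i) g x \<bullet> v)) (at x within bspace blk i)"
proof -
  let ?V = "bspace blk i"
  obtain D where D: "(g has_derivative D) (at x within ?V)"
    using g x unfolding differentiable_on_def differentiable_def by blast
  define u where "u = bproj blk i (adjoint D 1)"
  have lin: "linear D" using has_derivative_bounded_linear[OF D] by (rule bounded_linear.linear)
  have eq: "D v = u \<bullet> v" if "v \<in> ?V" for v
  proof -
    have "D v = v \<bullet> adjoint D 1" using adjoint_works[OF lin, of v 1] by simp
    also have "\<dots> = bproj blk i v \<bullet> adjoint D 1" using that by (simp add: bproj_of_bspace)
    also have "\<dots> = v \<bullet> u" unfolding u_def by (rule inner_bproj)
    finally show ?thesis by (simp only: inner_commute)
  qed
  have "(g has_derivative (\<lambda>v. u \<bullet> v)) (at x within ?V)"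
    unfolding has_derivative_within
  proof
    show "bounded_linear (\<lambda>v. u \<bullet> v)" by (rule bounded_linear_inner_right)
    have "((\<lambda>y. (1 / norm (y - x)) *\<^sub>R (g y - (g x + D (y - x)))) \<longlongrightarrow> 0) (at x within ?V)"
      using D unfolding has_derivative_within by blast
    then show "((\<lambda>y. (1 / norm (y - x)) *\<^sub>R (g y - (g x + u \<bullet> (y - x)))) \<longlongrightarrow> 0) (at x within ?V)"
    proof (rule Lim_transform_within[OF _ zero_less_one])
      fix y assume "y \<in> ?V"
      then have "y - x \<in> ?V" using x by (intro subspace_diff[OF subspace_bspace])
      then show "(1 / norm (y - x)) *\<^sub>R (g y - (g x + D (y - x))) = (1 / norm (y - x)) *\<^sub>R (g y - (g x + u \<bullet> (y - x)))"
        by (simp add: eq)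
    qed
  qed
  moreover from grad_on_eqI[OF subspace_bspace x _ this] have "grad_on ?V g x = u"
    by (simp add: u_def bproj_in_bspace)
  ultimately show ?thesis by simp
qed

lemma pgrad_eq:
  assumes f': "(f has_derivative (\<lambda>h. g \<bullet> h)) (at z)"
  shows "pgrad blk f i z = bproj blk i g"
  unfolding pgrad_def
proof (rule grad_on_eqI[OF subspace_bspace bproj_in_bspace bproj_in_bspace])
  have bupd: "bupd blk i z w = (z - bproj blk i z) + bproj blk i w" for w
    by (auto simp: bupd_def bproj_component vec_eq_iff)
  have "((\<lambda>w. bupd blk i z w) has_derivative bproj blk i) (at (bproj blk i z) within bspace blk i)"
    unfolding bupd
    by (rule derivative_eq_intros linear_imp_has_derivative[OF linear_bproj] refl | simp)+
  then have "((\<lambda>w. f (bupd blk i z w)) has_derivative (\<lambda>v. g \<bullet> bproj blk i v))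
      (at (bproj blk i z) within bspace blk i)"
  proof (rule has_derivative_compose)
    show "(f has_derivative (\<lambda>h. g \<bullet> h)) (at (bupd blk i z (bproj blk i z)))"
      using f' by (simp add: bupd bproj_of_bspace[OF bproj_in_bspace])
  qed
  then show "((\<lambda>w. f (bupd blk i z w)) has_derivative (\<lambda>v. bproj blk i g \<bullet> v))
      (at (bproj blk i z) within bspace blk i)"
    by (simp add: inner_bproj)
qed

text \<open>
  The gradient inequality relative to a subspace, reduced to the function on the real line that is
  obtained by restricting to the line through \<open>x\<close> and \<open>y\<close>.
\<close>

lemma convex_above_tangent:
  fixes g :: "'a::euclidean_space \<Rightarrow> real"
  assumes V: "subspace V" and g: "convex_on V g" and x: "x \<in> V" and y: "y \<in> V"
    and g': "(g has_derivative (\<lambda>v. u \<bullet> v)) (at x within V)"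
  shows "u \<bullet> (y - x) \<le> g y - g x"
proof -
  let ?l = "\<lambda>t::real. x + t *\<^sub>R (y - x)"
  have lV: "?l t \<in> V" for t
    using V x y by (intro subspace_add subspace_scale subspace_diff)
  have dl: "(?l has_derivative (\<lambda>s. s *\<^sub>R (y - x))) (at 0)"
    by (auto intro!: derivative_eq_intros)
  have "(g has_derivative (\<lambda>v. u \<bullet> v)) (at (?l 0) within range ?l)"
    using has_derivative_subset[OF g', of "range ?l"] lV by auto
  from has_derivative_in_compose[OF dl this]
  have d: "((\<lambda>t. g (?l t)) has_real_derivative (u \<bullet> (y - x))) (at 0)"
    by (rule has_derivative_imp_has_field_derivative) (simp add: mult.commute)
  have "convex_on UNIV (\<lambda>t. g (?l t))"
  proof (rule convex_onI)
    fix t a b :: real assume t: "0 < t" "t < 1"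
    have "?l ((1 - t) *\<^sub>R a + t *\<^sub>R b) = (1 - t) *\<^sub>R ?l a + t *\<^sub>R ?l b"
      by (simp add: algebra_simps)
    then show "g (?l ((1 - t) *\<^sub>R a + t *\<^sub>R b)) \<le> (1 - t) * g (?l a) + t * g (?l b)"
      using convex_onD[OF g, of t "?l a" "?l b"] t lV by simp
  qed simp
  from convex_on_imp_above_tangent[OF this, of 0 1] d show ?thesis by simp
qed

lemma residual_parts_le:
  assumes r: "residual blk p h i x lam xt \<le> c" and p: "1 \<le> p i"
  shows "x \<bullet> (x - xt + jac_mult blk p h i x lam) \<le> c"
    and "infnorm (x - xt + jac_mult blk p h i x lam) \<le> c"
    and "- (\<Sum>j=1..p i. lam j * h i j x) \<le> c"
    and "\<And>j. j \<in> {1..p i} \<Longrightarrow> max (h i j x) 0 \<le> c"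
    and "0 \<le> c"
proof -
  have M: "\<bar>max (h i j x) 0\<bar> \<le> Max ((\<lambda>j. \<bar>max (h i j x) 0\<bar>) ` {1..p i})" if "j \<in> {1..p i}" for j
    using that by (intro Max_ge) auto
  have "0 \<le> Max ((\<lambda>j. \<bar>max (h i j x) 0\<bar>) ` {1..p i})"
    using M[of 1] p by (smt (verit) atLeastAtMost_iff order_refl)
  note nn = this infnorm_pos_le[of "x - xt + jac_mult blk p h i x lam"]
  show "x \<bullet> (x - xt + jac_mult blk p h i x lam) \<le> c" "infnorm (x - xt + jac_mult blk p h i x lam) \<le> c"
    "- (\<Sum>j=1..p i. lam j * h i j x) \<le> c" "0 \<le> c"
    using r nn unfolding residual_def by linarith+
  show "max (h i j x) 0 \<le> c" if "j \<in> {1..p i}" for j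
    using r nn M[OF that] unfolding residual_def by linarith
qed

text \<open>
  The residual test says that \<open>x\<close> is nearly the projection of \<open>xt\<close> onto the feasible set. Convexity of
  the constraints and approximate complementarity bound the multiplier term
  \<open>jac_mult blk p h i x lam \<bullet> (y - x)\<close> by \<open>c\<close>. The remaining error \<open>?e\<close> in the stationarity equation is
  tested against \<open>y\<close>, where boundedness of \<open>y\<close> helps, and against \<open>x\<close>, where the residual contains
  exactly the required bound.
\<close>

lemma residual_approx_projection:
  fixes y :: "real^'d"
  assumes r: "residual blk p h i x lam xt \<le> c" and p: "1 \<le> p i"
    and x: "x \<in> bspace blk i" and lam: "\<And>j. j \<in> {1..p i} \<Longrightarrow> 0 \<le> lam j"
    and h: "\<And>j. j \<in> {1..p i} \<Longrightarrow> convex_on (bspace blk i) (h i j)"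
      "\<And>j. j \<in> {1..p i} \<Longrightarrow> h i j differentiable_on bspace blk i"
    and y: "y \<in> feas blk p h i" and R: "norm y \<le> R"
  shows "(y - x) \<bullet> (xt - x) \<le> (2 + R * sqrt (real CARD('d))) * c"
proof -
  note parts = residual_parts_le[OF r p]
  let ?V = "bspace blk i"
  let ?J = "jac_mult blk p h i x lam"
  let ?e = "x - xt + ?J"
  have yV: "y \<in> ?V" and hy: "\<And>j. j \<in> {1..p i} \<Longrightarrow> h i j y \<le> 0" using y by (auto simp: feas_def)
  have "?J \<bullet> (y - x) = (\<Sum>j=1..p i. lam j * (grad_on ?V (h i j) x \<bullet> (y - x)))"
    by (simp add: jac_mult_def inner_sum_left)
  also have "\<dots> \<le> (\<Sum>j=1..p i. lam j * (- h i j x))"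
  proof (rule sum_mono)
    fix j assume j: "j \<in> {1..p i}"
    have "grad_on ?V (h i j) x \<bullet> (y - x) \<le> h i j y - h i j x"
      by (rule convex_above_tangent[OF subspace_bspace h(1)[OF j] x yV grad_on_bspace[OF h(2)[OF j] x]])
    then show "lam j * (grad_on ?V (h i j) x \<bullet> (y - x)) \<le> lam j * (- h i j x)"
      using hy[OF j] lam[OF j] by (intro mult_left_mono) auto
  qed
  also have "\<dots> \<le> c" using parts(3) by (simp add: sum_negf)
  finally have J: "?J \<bullet> (y - x) \<le> c" .
  have "- (y \<bullet> ?e) \<le> norm y * norm ?e" using Cauchy_Schwarz_ineq2[of y ?e] by linarith
  also have "\<dots> \<le> R * (sqrt (real CARD('d)) * c)"
  proof (intro mult_mono R)
    have "norm ?e \<le> sqrt DIM(real^'d) * infnorm ?e" by (rule norm_le_infnorm)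
    also have "\<dots> \<le> sqrt (real CARD('d)) * c" using parts(2) by (simp add: mult_left_mono)
    finally show "norm ?e \<le> sqrt (real CARD('d)) * c" .
  qed (use R order_trans[OF norm_ge_zero R] in auto)
  finally have ye: "- (y \<bullet> ?e) \<le> R * sqrt (real CARD('d)) * c" by (simp add: mult.assoc)
  have "(y - x) \<bullet> (xt - x) = ?J \<bullet> (y - x) - y \<bullet> ?e + x \<bullet> ?e"
    by (simp add: inner_diff_left inner_diff_right inner_add_left inner_add_right inner_commute)
  then show ?thesis using J ye parts(1) by (simp add: algebra_simps)
qed

section \<open>Runs of PALM-I\<close>

text \<open>
  The standing assumptions on the problem and on the run. The Lojasiewicz property and the condition
  on the tails of the tolerances enter only with the final theorem of the context.
\<close>

locale palm_setting =
  fixes blk :: "'d::finite \<Rightarrow> nat" and n :: nat and p :: "nat \<Rightarrow> nat"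
    and f :: "real^'d \<Rightarrow> real" and h :: "nat \<Rightarrow> nat \<Rightarrow> real^'d \<Rightarrow> real"
    and z :: "nat \<Rightarrow> real^'d" and \<sigma> :: "nat \<Rightarrow> nat \<Rightarrow> real"
    and \<epsilon> :: "nat \<Rightarrow> real" and eb \<gamma> M :: real and L :: "nat \<Rightarrow> real"
  assumes blocks: "range blk = {1..n}"
    and p_pos: "\<And>i. i \<in> {1..n} \<Longrightarrow> p i \<ge> 1"
    and f_diff: "f differentiable_on UNIV"
    and h_convex: "\<And>i j. i \<in> {1..n} \<Longrightarrow> j \<in> {1..p i} \<Longrightarrow> convex_on (bspace blk i) (h i j)"
    and h_diff: "\<And>i j. i \<in> {1..n} \<Longrightarrow> j \<in> {1..p i} \<Longrightarrow> h i j differentiable_on bspace blk i"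
    and gamma: "\<gamma> > 1"
    and run: "palm_I blk n p h f eb \<epsilon> (\<gamma> * Max (L ` {1..n})) M \<sigma> z"
    and L_pos: "\<And>i. i \<in> {1..n} \<Longrightarrow> L i > 0"
    and lipschitz: "\<And>i z1 z2. i \<in> {1..n} \<Longrightarrow> z1 \<in> bprod blk n (feas_bar blk p h eb) \<Longrightarrow>
          z2 \<in> bprod blk n (feas_bar blk p h eb) \<Longrightarrow>
          norm (pgrad blk f i z1 - pgrad blk f i z2) \<le> L i * norm (z1 - z2)"
    and S_convex: "\<And>i. i \<in> {1..n} \<Longrightarrow> convex (feas blk p h i)"
    and S_compact: "\<And>i. i \<in> {1..n} \<Longrightarrow> compact (feas blk p h i)"
    and cq: "\<And>i. i \<in> {1..n} \<Longrightarrow> linear_constr blk p h i \<or> slater blk p h i"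
    and error_bound: "\<And>i. i \<in> {1..n} \<Longrightarrow> \<exists>c\<ge>0.
          \<forall>w\<in>feas_tilde blk n p h f eb (\<gamma> * Max (L ` {1..n})) i.
            edist_set w (feas blk p h i) \<le> ereal (c * L2_set (\<lambda>j. max (h i j w) 0) {1..p i})"
    and eps_summable: "summable \<epsilon>"
begin

abbreviation "V \<equiv> bspace blk"
abbreviation "P \<equiv> bproj blk"
abbreviation "Si \<equiv> feas blk p h"
abbreviation "Bi \<equiv> feas_bar blk p h eb"
definition "S = bprod blk n Si"
definition "B = bprod blk n Bi"
definition "Lm = Max (L ` {1..n})"
definition "G x = (SOME g. (f has_derivative (\<lambda>v. g \<bullet> v)) (at x))"

lemma G: "(f has_derivative (\<lambda>v. G x \<bullet> v)) (at x)"
proof -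
  obtain D where D: "(f has_derivative D) (at x)"
    using f_diff unfolding differentiable_on_def differentiable_def by auto
  then have "linear D" by (intro bounded_linear.linear has_derivative_bounded_linear)
  then have "D v = adjoint D 1 \<bullet> v" for v
    using adjoint_works[of D v 1] by (simp add: inner_commute)
  then have "(f has_derivative (\<lambda>v. adjoint D 1 \<bullet> v)) (at x)" using D by (metis (no_types, lifting) ext)
  then show ?thesis unfolding G_def by (rule someI)
qed

lemma pgrad_G: "pgrad blk f i x = P i (G x)"
  by (rule pgrad_eq[OF G])

lemma blk_in: "blk d \<in> {1..n}" using blocks by blast

lemma L_le: "i \<in> {1..n} \<Longrightarrow> L i \<le> Lm"
  unfolding Lm_def by (intro Max_ge) auto

lemma Lm_pos: "0 < Lm"
  using L_le[OF blk_in[of undefined]] L_pos[OF blk_in[of undefined]] by linarith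

lemma eb_pos: "0 < eb" and eps_nonneg: "0 \<le> \<epsilon> k"
  and sigma: "i \<in> {1..n} \<Longrightarrow> \<gamma> * Lm \<le> \<sigma> k i" "i \<in> {1..n} \<Longrightarrow> \<sigma> k i \<le> M"
  using run unfolding palm_I_def Lm_def by auto

lemma sigma_pos: "i \<in> {1..n} \<Longrightarrow> 0 < \<sigma> k i"
  using sigma(1)[of i k] gamma Lm_pos by (smt (verit) mult_pos_pos)

lemma multipliers:
  assumes "i \<in> {1..n}"
  obtains lam where "\<And>j. j \<in> {1..p i} \<Longrightarrow> 0 \<le> lam j"
    "residual blk p h i (P i (z (Suc k))) lam (palm_target blk f \<sigma> z k i) \<le> (\<epsilon> k)\<^sup>2"
  using run assms unfolding palm_I_def by (meson sqrt_le_D)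

lemma violation_le:
  assumes i: "i \<in> {1..n}" and j: "j \<in> {1..p i}"
  shows "max (h i j (P i (z (Suc k)))) 0 \<le> (\<epsilon> k)\<^sup>2"
proof -
  obtain lam where "residual blk p h i (P i (z (Suc k))) lam (palm_target blk f \<sigma> z k i) \<le> (\<epsilon> k)\<^sup>2"
    by (rule multipliers[OF i])
  from residual_parts_le(4)[OF this p_pos[OF i] j] show ?thesis .
qed

lemma eps2_eventually: "0 < m \<Longrightarrow> \<forall>\<^sub>F k in sequentially. (\<epsilon> k)\<^sup>2 < m"
proof -
  assume m: "0 < m"
  have "(\<lambda>k. (\<epsilon> k)\<^sup>2) \<longlonglongrightarrow> 0\<^sup>2" by (intro tendsto_intros summable_LIMSEQ_zero eps_summable)
  then show ?thesis using m by (intro order_tendstoD(2)[of _ "0\<^sup>2"]) auto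
qed

text \<open>
  Under the Slater condition this is immediate. For affine constraints the run itself is the reason:
  its iterates violate the constraints by at most \<open>(\<epsilon> k)\<^sup>2\<close>, which tends to 0.
\<close>

lemma feas_nonempty:
  assumes i: "i \<in> {1..n}"
  shows "Si i \<noteq> {}"
proof (cases "slater blk p h i")
  case True
  then show ?thesis unfolding slater_def feas_def by (auto intro: less_imp_le)
next
  case False
  then have "linear_constr blk p h i" using cq[OF i] by blast
  then obtain a c where ac: "\<And>j w. j \<in> {1..p i} \<Longrightarrow> w \<in> V i \<Longrightarrow> h i j w = a j \<bullet> w + c j"
    unfolding linear_constr_def by metis
  have "\<exists>w. \<forall>j\<in>{1..p i}. P i (a j) \<bullet> w + c j \<le> 0"
  proof (rule affine_system_feasible)
    fix m :: real assume "0 < m"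
    then obtain k where k: "(\<epsilon> k)\<^sup>2 < m"
      using eventually_happens'[OF sequentially_bot eps2_eventually] by blast
    have "P i (a j) \<bullet> P i (z (Suc k)) + c j \<le> m" if j: "j \<in> {1..p i}" for j
      using violation_le[OF i j, of k] k ac[OF j bproj_in_bspace[of blk i "z (Suc k)"]]
      by (simp add: inner_bproj bproj_of_bspace[OF bproj_in_bspace])
    then show "\<exists>w. \<forall>j\<in>{1..p i}. P i (a j) \<bullet> w + c j \<le> m" by blast
  qed simp
  then obtain w where w: "\<And>j. j \<in> {1..p i} \<Longrightarrow> P i (a j) \<bullet> w + c j \<le> 0" by blast
  have "P i w \<in> Si i"
    unfolding feas_def using w ac bproj_in_bspace[of blk i w] by (auto simp: inner_bproj)
  then show ?thesis by blast
qed

lemma closed_feas: "i \<in> {1..n} \<Longrightarrow> closed (Si i)"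
  by (intro compact_imp_closed S_compact)

lemma feas_bar_eq:
  assumes "i \<in> {1..n}"
  shows "Bi i = {w \<in> V i. \<exists>q\<in>Si i. norm (w - q) \<le> eb}"
  unfolding feas_bar_def edist_set_le_iff[OF closed_feas[OF assms] feas_nonempty[OF assms]] ..

lemma feas_sub: "i \<in> {1..n} \<Longrightarrow> Si i \<subseteq> Bi i"
  using eb_pos by (auto simp: feas_bar_eq) (auto simp: feas_def intro: less_imp_le)

lemma feas_sub_V: "Si i \<subseteq> V i"
  by (auto simp: feas_def)

lemma convex_feas_bar:
  assumes i: "i \<in> {1..n}" shows "convex (Bi i)"
proof -
  have "(\<exists>q\<in>Si i. norm (w - q) \<le> eb) \<longleftrightarrow> w \<in> (\<Union>x\<in>Si i. \<Union>y\<in>cball 0 eb. {x + y})" for w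
  proof
    assume "\<exists>q\<in>Si i. norm (w - q) \<le> eb"
    then obtain q where "q \<in> Si i" "w - q \<in> cball 0 eb" "w = q + (w - q)" by auto
    then show "w \<in> (\<Union>x\<in>Si i. \<Union>y\<in>cball 0 eb. {x + y})" by blast
  qed (auto intro!: bexI)
  then have "Bi i = V i \<inter> (\<Union>x\<in>Si i. \<Union>y\<in>cball 0 eb. {x + y})"
    unfolding feas_bar_eq[OF i] by blast
  then show ?thesis
    using S_convex[OF i]
    by (simp add: convex_Int convex_sums subspace_imp_convex subspace_bspace)
qed

lemma bounded_feas_bar:
  assumes i: "i \<in> {1..n}" shows "bounded (Bi i)"
proof -
  obtain R where R: "\<And>q. q \<in> Si i \<Longrightarrow> norm q \<le> R"
    using compact_imp_bounded[OF S_compact[OF i]] unfolding bounded_iff by blast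
  have "norm w \<le> R + eb" if w: "w \<in> Bi i" for w
  proof -
    obtain q where "q \<in> Si i" "norm (w - q) \<le> eb" using w feas_bar_eq[OF i] by blast
    then show ?thesis using R norm_triangle_sub[of w q] by fastforce
  qed
  then show ?thesis unfolding bounded_iff by blast
qed

lemma S_props: "convex S" "compact S" "S \<noteq> {}" "S \<subseteq> B" "convex B" "bounded B"
proof -
  show "convex S" unfolding S_def by (intro convex_bprod S_convex)
  show "compact S" unfolding S_def compact_eq_bounded_closed
    by (intro conjI bounded_bprod closed_bprod blocks closed_feas compact_imp_bounded S_compact)
  obtain q where "\<And>i. i \<in> {1..n} \<Longrightarrow> P i q \<in> Si i"
    using blockwise_choice[OF blocks, of "\<lambda>i q. q \<in> Si i"] feas_nonempty feas_sub_V by blast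
  then have "q \<in> S" by (simp add: S_def bprod_def)
  then show "S \<noteq> {}" by blast
  show "S \<subseteq> B" unfolding S_def B_def bprod_def using feas_sub by blast
  show "convex B" unfolding B_def by (intro convex_bprod convex_feas_bar)
  show "bounded B" unfolding B_def by (intro bounded_bprod blocks bounded_feas_bar)
qed

text \<open>
  The starting point is arbitrary and the first tolerances may be large, so the Lipschitz condition and
  the error bound become available only from some iterate on.
\<close>

lemma eventually_block_in_feas_bar:
  assumes i: "i \<in> {1..n}"
  shows "\<forall>\<^sub>F k in sequentially. P i (z (Suc k)) \<in> Bi i"
proof -
  obtain m where m: "0 < m"
    "\<And>w. w \<in> V i \<Longrightarrow> (\<And>j. j \<in> {1..p i} \<Longrightarrow> h i j w \<le> m) \<Longrightarrow> \<exists>q\<in>Si i. norm (w - q) \<le> eb"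
  proof (rule convex_sublevel_near)
    show "convex (V i)" "closed (V i)"
      by (simp_all add: subspace_imp_convex closed_subspace subspace_bspace)
    show "Si i = {w \<in> V i. \<forall>j\<in>{1..p i}. h i j w \<le> 0}" by (rule feas_def)
    show "continuous_on (V i) (h i j)" if "j \<in> {1..p i}" for j
      by (rule differentiable_imp_continuous_on[OF h_diff[OF i that]])
  qed (use i feas_nonempty S_compact eb_pos h_convex in blast)+
  show ?thesis
    using eps2_eventually[OF m(1)]
  proof eventually_elim
    case (elim k)
    have "h i j (P i (z (Suc k))) \<le> m" if "j \<in> {1..p i}" for j
      using violation_le[OF i that, of k] elim by simp
    then show ?case using m(2)[OF bproj_in_bspace] by (auto simp: feas_bar_eq[OF i] bproj_in_bspace)
  qed
qed

lemma eventually_in_B: "\<forall>\<^sub>F k in sequentially. z (Suc k) \<in> B"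
proof -
  have "\<forall>\<^sub>F k in sequentially. \<forall>i\<in>{1..n}. P i (z (Suc k)) \<in> Bi i"
    by (intro eventually_ball_finite ballI eventually_block_in_feas_bar) auto
  then show ?thesis by (simp add: B_def bprod_def)
qed

text \<open>
  The feasible sets are nonempty, so \<open>M_bar\<close> is a supremum over a nonempty set and hence nonnegative; over
  the empty set it would be \<open>- \<infinity>\<close>.
\<close>

lemma feas_bar_sub_tilde:
  assumes i: "i \<in> {1..n}"
  shows "Bi i \<subseteq> feas_tilde blk n p h f eb (\<gamma> * Lm) i"
proof
  fix w assume w: "w \<in> Bi i"
  obtain s where s: "s \<in> bprod blk n Bi" using S_props(3,4) by (auto simp: B_def)
  have "(0::ereal) \<le> ereal (norm (pgrad blk f i s))" by simp
  also have "\<dots> \<le> M_bar blk n p h f eb i" unfolding M_bar_def using s by (rule SUP_upper)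
  finally have "0 \<le> M_bar blk n p h f eb i / ereal (\<gamma> * Lm)"
    using gamma Lm_pos by (intro zero_le_divide_ereal) auto
  moreover have "edist_set w (Bi i) \<le> 0"
    unfolding edist_set_def using w by (auto intro!: INF_lower2)
  ultimately show "w \<in> feas_tilde blk n p h f eb (\<gamma> * Lm) i"
    using w by (auto simp: feas_tilde_def feas_bar_def)
qed

lemma block_near_feas:
  obtains c where "0 \<le> c" "\<And>i k. i \<in> {1..n} \<Longrightarrow> P i (z (Suc k)) \<in> Bi i \<Longrightarrow>
    \<exists>q\<in>Si i. norm (P i (z (Suc k)) - q) \<le> c * (\<epsilon> k)\<^sup>2"
proof -
  obtain c where c: "\<And>i. i \<in> {1..n} \<Longrightarrow> 0 \<le> c i"
    "\<And>i w. i \<in> {1..n} \<Longrightarrow> w \<in> feas_tilde blk n p h f eb (\<gamma> * Lm) i \<Longrightarrow>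
      edist_set w (Si i) \<le> ereal (c i * L2_set (\<lambda>j. max (h i j w) 0) {1..p i})"
    using error_bound unfolding Lm_def[symmetric] by metis
  define C where "C = (\<Sum>i=1..n. c i * real (p i))"
  have "\<exists>q\<in>Si i. norm (P i (z (Suc k)) - q) \<le> C * (\<epsilon> k)\<^sup>2"
    if i: "i \<in> {1..n}" and inB: "P i (z (Suc k)) \<in> Bi i" for i k
  proof -
    let ?w = "P i (z (Suc k))"
    have "L2_set (\<lambda>j. max (h i j ?w) 0) {1..p i} \<le> (\<Sum>j=1..p i. \<bar>max (h i j ?w) 0\<bar>)"
      by (rule L2_set_le_sum_abs)
    also have "\<dots> \<le> (\<Sum>j=1..p i. (\<epsilon> k)\<^sup>2)"
      using violation_le[OF i, of _ k] by (intro sum_mono) auto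
    finally have "c i * L2_set (\<lambda>j. max (h i j ?w) 0) {1..p i} \<le> c i * (real (p i) * (\<epsilon> k)\<^sup>2)"
      using c(1)[OF i] by (intro mult_left_mono) auto
    also have "\<dots> = (c i * real (p i)) * (\<epsilon> k)\<^sup>2" by simp
    also have "\<dots> \<le> C * (\<epsilon> k)\<^sup>2"
      unfolding C_def using i c(1) by (intro mult_right_mono member_le_sum) auto
    finally have "ereal (c i * L2_set (\<lambda>j. max (h i j ?w) 0) {1..p i}) \<le> ereal (C * (\<epsilon> k)\<^sup>2)" by simp
    with c(2)[OF i subsetD[OF feas_bar_sub_tilde[OF i] inB]]
    have "edist_set ?w (Si i) \<le> ereal (C * (\<epsilon> k)\<^sup>2)" by (rule order_trans)
    then show ?thesis using edist_set_le_iff[OF closed_feas[OF i] feas_nonempty[OF i]] by blast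
  qed
  moreover have "0 \<le> C" unfolding C_def using c(1) by (intro sum_nonneg) auto
  ultimately show thesis using that by blast
qed

lemma iterate_near_S:
  obtains c where "0 \<le> c" "\<And>k. z (Suc k) \<in> B \<Longrightarrow> infdist (z (Suc k)) S \<le> c * (\<epsilon> k)\<^sup>2"
proof -
  obtain c where c: "0 \<le> c" "\<And>i k. i \<in> {1..n} \<Longrightarrow> P i (z (Suc k)) \<in> Bi i \<Longrightarrow>
    \<exists>q\<in>Si i. norm (P i (z (Suc k)) - q) \<le> c * (\<epsilon> k)\<^sup>2"
    by (rule block_near_feas) blast
  have "infdist (z (Suc k)) S \<le> (real n * c) * (\<epsilon> k)\<^sup>2" if "z (Suc k) \<in> B" for k
  proof -
    have "\<exists>q\<in>V i. q \<in> Si i \<and> norm (P i (z (Suc k)) - q) \<le> c * (\<epsilon> k)\<^sup>2" if i: "i \<in> {1..n}" for i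
      using c(2)[OF i, of k] \<open>z (Suc k) \<in> B\<close> i feas_sub_V[of i] by (auto simp: B_def bprod_def)
    then obtain q where q: "\<And>i. i \<in> {1..n} \<Longrightarrow> P i q \<in> Si i \<and> norm (P i (z (Suc k)) - P i q) \<le> c * (\<epsilon> k)\<^sup>2"
      using blockwise_choice[OF blocks, of "\<lambda>i q. q \<in> Si i \<and> norm (P i (z (Suc k)) - q) \<le> c * (\<epsilon> k)\<^sup>2"]
      by blast
    have "infdist (z (Suc k)) S \<le> norm (z (Suc k) - q)"
      using q by (intro infdist_le2[of q]) (auto simp: S_def bprod_def dist_norm)
    also have "\<dots> \<le> real n * (c * (\<epsilon> k)\<^sup>2)"
      using q by (intro norm_le_of_blocks[OF blocks]) (simp add: bproj_diff)
    finally show ?thesis by (simp add: mult.assoc)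
  qed
  then show thesis using that[of "real n * c"] c(1) by simp
qed

text \<open>
  The blocks of \<open>g k\<close> are the partial gradients that are used in one sweep, each taken at its own mixed
  point. The vector \<open>v k\<close> is the displacement from the new iterate to the target of the projection,
  with block \<open>i\<close> rescaled by \<open>\<sigma> k i\<close> (lemma \<open>P_v_target\<close>). With this scaling the optimality
  conditions of the blocks, whose step sizes may differ, add up to one inequality for \<open>v k\<close>.
\<close>

definition "g k = (\<chi> d. G (mixed blk (blk d) (z (Suc k)) (z k)) $ d)"
definition "v k = (\<chi> d. \<sigma> k (blk d) * (z k - z (Suc k)) $ d) - g k"

lemma P_g: "P i (g k) = pgrad blk f i (mixed blk i (z (Suc k)) (z k))"
  by (auto simp: g_def pgrad_G vec_eq_iff bproj_component)

lemma P_v: "P i (v k) = \<sigma> k i *\<^sub>R P i (z k - z (Suc k)) - P i (g k)"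
  by (auto simp: v_def vec_eq_iff bproj_component)

lemma P_v_target:
  assumes "i \<in> {1..n}"
  shows "P i (v k) = \<sigma> k i *\<^sub>R (palm_target blk f \<sigma> z k i - P i (z (Suc k)))"
  using sigma_pos[OF assms, of k]
  by (simp add: P_v P_g palm_target_def bproj_diff algebra_simps)

lemma approx_optimality:
  obtains c where "0 \<le> c" "\<And>k y. y \<in> S \<Longrightarrow> (y - z (Suc k)) \<bullet> v k \<le> c * (\<epsilon> k)\<^sup>2"
proof -
  obtain R where R: "\<And>y. y \<in> S \<Longrightarrow> norm y \<le> R"
    using compact_imp_bounded[OF S_props(2)] unfolding bounded_iff by blast
  define C where "C = 2 + \<bar>R\<bar> * sqrt (real CARD('d))"
  have C: "0 \<le> C" by (simp add: C_def)
  have M: "0 \<le> M" using sigma_pos[OF blk_in[of undefined], of 0] sigma(2)[OF blk_in[of undefined], of 0] by linarith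
  have "(y - z (Suc k)) \<bullet> v k \<le> (real n * (M * C)) * (\<epsilon> k)\<^sup>2" if y: "y \<in> S" for k y
  proof -
    have "P i (y - z (Suc k)) \<bullet> P i (v k) \<le> M * C * (\<epsilon> k)\<^sup>2" if i: "i \<in> {1..n}" for i
    proof -
      obtain lam where lam: "\<And>j. j \<in> {1..p i} \<Longrightarrow> 0 \<le> lam j"
        "residual blk p h i (P i (z (Suc k))) lam (palm_target blk f \<sigma> z k i) \<le> (\<epsilon> k)\<^sup>2"
        by (rule multipliers[OF i]) blast
      have nP: "norm (P i y) \<le> \<bar>R\<bar>" using R[OF y] norm_bproj_le[of blk i y] by linarith
      have yi: "P i y \<in> Si i" using y i by (auto simp: S_def bprod_def)
      have "(P i y - P i (z (Suc k))) \<bullet> (palm_target blk f \<sigma> z k i - P i (z (Suc k))) \<le> C * (\<epsilon> k)\<^sup>2"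
        unfolding C_def
        by (rule residual_approx_projection[OF lam(2) p_pos[OF i] bproj_in_bspace lam(1)
              h_convex[OF i] h_diff[OF i] yi nP])
      then have "\<sigma> k i * ((P i y - P i (z (Suc k))) \<bullet> (palm_target blk f \<sigma> z k i - P i (z (Suc k))))
          \<le> \<sigma> k i * (C * (\<epsilon> k)\<^sup>2)"
        using sigma_pos[OF i, of k] by (intro mult_left_mono) auto
      also have "\<dots> \<le> M * (C * (\<epsilon> k)\<^sup>2)"
        using sigma(2)[OF i, of k] C by (intro mult_right_mono) auto
      finally show ?thesis by (simp add: P_v_target[OF i] bproj_diff mult.assoc)
    qed
    then have "(\<Sum>i=1..n. P i (y - z (Suc k)) \<bullet> P i (v k)) \<le> real (card {1..n}) * (M * C * (\<epsilon> k)\<^sup>2)"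
      by (rule sum_bounded_above)
    then show ?thesis unfolding inner_eq_sum_blocks[OF blocks, of "y - z (Suc k)"] by (simp add: mult_ac)
  qed
  then show thesis using that[of "real n * (M * C)"] C M by simp
qed

lemma G_lipschitz:
  assumes "x \<in> B" "y \<in> B"
  shows "norm (G x - G y) \<le> (real n * Lm) * norm (x - y)"
proof -
  have "norm (P i (G x - G y)) \<le> Lm * norm (x - y)" if i: "i \<in> {1..n}" for i
  proof -
    have "norm (P i (G x - G y)) \<le> L i * norm (x - y)"
      using lipschitz[OF i] assms by (simp add: B_def pgrad_G bproj_diff)
    also have "\<dots> \<le> Lm * norm (x - y)" using L_le[OF i] by (intro mult_right_mono) auto
    finally show ?thesis .
  qed
  from norm_le_of_blocks[OF blocks this] show ?thesis by (simp add: mult.assoc)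
qed

lemma residual_gradient:
  assumes "z k \<in> B" "z (Suc k) \<in> B"
  shows "norm (v k + G (z (Suc k))) \<le> (real n * (M + Lm)) * norm (z (Suc k) - z k)"
proof -
  have "norm (P i (v k + G (z (Suc k)))) \<le> (M + Lm) * norm (z (Suc k) - z k)" if i: "i \<in> {1..n}" for i
  proof -
    let ?m = "mixed blk i (z (Suc k)) (z k)"
    have mB: "?m \<in> B" using assms by (auto simp: B_def intro: mixed_in_bprod)
    have "P i (v k + G (z (Suc k))) = \<sigma> k i *\<^sub>R P i (z k - z (Suc k)) + (pgrad blk f i (z (Suc k)) - pgrad blk f i ?m)"
      by (simp add: P_v P_g bproj_add pgrad_G)
    then have "norm (P i (v k + G (z (Suc k)))) \<le> norm (\<sigma> k i *\<^sub>R P i (z k - z (Suc k)))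
        + norm (pgrad blk f i (z (Suc k)) - pgrad blk f i ?m)"
      using norm_triangle_ineq by metis
    also have "norm (\<sigma> k i *\<^sub>R P i (z k - z (Suc k))) \<le> M * norm (z (Suc k) - z k)"
      using sigma_pos[OF i, of k] sigma(2)[OF i, of k] norm_bproj_le[of blk i "z k - z (Suc k)"]
      by (auto simp: norm_minus_commute intro!: mult_mono)
    also have "norm (pgrad blk f i (z (Suc k)) - pgrad blk f i ?m) \<le> L i * norm (z (Suc k) - ?m)"
      using lipschitz[OF i] assms(2) mB by (simp add: B_def)
    also have "\<dots> \<le> Lm * norm (z (Suc k) - z k)"
      using L_le[OF i] Lm_pos norm_mixed_le by (intro mult_mono) auto
    finally show ?thesis by (simp add: algebra_simps)
  qed
  from norm_le_of_blocks[OF blocks this] show ?thesis by (simp add: mult.assoc)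
qed

text \<open>
  The updates of a sweep are added up over the intermediate points. In block \<open>i\<close> the partial gradient
  equals \<open>- (\<sigma> k i *\<^sub>R ?d i) - P i (v k)\<close>, and the quadratic term \<open>- \<sigma> k i * (norm (?d i))\<^sup>2\<close> that it
  produces outweighs the error \<open>Lm * (norm (?d i))\<^sup>2\<close> of the linearization because
  \<open>\<sigma> k i \<ge> \<gamma> * Lm\<close> with \<open>\<gamma> > 1\<close>.
\<close>

lemma sweep_descent:
  assumes zB: "z k \<in> B" "z (Suc k) \<in> B"
  shows "f (z (Suc k)) \<le> f (z k) - v k \<bullet> (z (Suc k) - z k) - ((\<gamma> - 1) * Lm) * (norm (z (Suc k) - z k))\<^sup>2"
proof -
  let ?m = "\<lambda>i. mixed blk i (z (Suc k)) (z k)"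
  let ?d = "\<lambda>i. P i (z (Suc k) - z k)"
  have mB: "?m i \<in> B" for i using zB by (auto simp: B_def intro: mixed_in_bprod)
  have block: "f (?m (Suc i)) - f (?m i) \<le> - (P i (v k) \<bullet> ?d i) - ((\<gamma> - 1) * Lm) * (norm (?d i))\<^sup>2"
    if i: "i \<in> {1..n}" for i
  proof -
    have "f (?m i + ?d i) \<le> f (?m i) + G (?m i) \<bullet> ?d i + Lm * (norm (?d i))\<^sup>2"
    proof (rule gradient_step_upper_bound[OF G])
      fix t :: real assume t: "t \<in> {0..1}"
      let ?x = "?m i + t *\<^sub>R ?d i"
      have "?x = (1 - t) *\<^sub>R ?m i + t *\<^sub>R ?m (Suc i)" by (simp add: mixed_Suc algebra_simps)
      then have xB: "?x \<in> B" using convexD_alt[OF S_props(5) mB mB, of t i "Suc i"] t by simp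
      have "(G ?x - G (?m i)) \<bullet> ?d i = P i (G ?x - G (?m i)) \<bullet> ?d i"
        by (simp add: inner_bproj bproj_of_bspace[OF bproj_in_bspace])
      also have "\<dots> \<le> norm (P i (G ?x - G (?m i))) * norm (?d i)" by (rule norm_cauchy_schwarz)
      also have "norm (P i (G ?x - G (?m i))) \<le> L i * norm (?x - ?m i)"
        using lipschitz[OF i, of ?x "?m i"] xB mB[of i] by (simp add: B_def pgrad_G bproj_diff)
      also have "L i * norm (?x - ?m i) \<le> Lm * norm (?d i)"
        using L_le[OF i] Lm_pos t by (intro mult_mono) (auto intro: mult_left_le_one_le)
      finally show "(G ?x - G (?m i)) \<bullet> ?d i \<le> Lm * (norm (?d i))\<^sup>2"
        by (simp add: power2_eq_square mult.assoc mult_right_mono)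
    qed
    also have "G (?m i) \<bullet> ?d i = P i (g k) \<bullet> ?d i"
      by (simp add: P_g pgrad_G inner_bproj bproj_of_bspace[OF bproj_in_bspace])
    also have "P i (g k) = - (\<sigma> k i *\<^sub>R ?d i) - P i (v k)"
      by (simp add: P_v bproj_diff algebra_simps)
    also have "(- (\<sigma> k i *\<^sub>R ?d i) - P i (v k)) \<bullet> ?d i = - \<sigma> k i * (norm (?d i))\<^sup>2 - P i (v k) \<bullet> ?d i"
      by (simp add: inner_diff_left power2_norm_eq_inner)
    finally have "f (?m (Suc i)) - f (?m i) \<le> - (P i (v k) \<bullet> ?d i) - (\<sigma> k i - Lm) * (norm (?d i))\<^sup>2"
      by (simp add: mixed_Suc algebra_simps)
    also have "\<dots> \<le> - (P i (v k) \<bullet> ?d i) - ((\<gamma> - 1) * Lm) * (norm (?d i))\<^sup>2"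
      using sigma(1)[OF i, of k] by (intro diff_left_mono mult_right_mono) (auto simp: algebra_simps)
    finally show ?thesis .
  qed
  have "f (z (Suc k)) - f (z k) = f (?m (Suc n)) - f (?m 1)"
    by (simp only: mixed_one[OF blocks] mixed_last[OF blocks])
  also have "\<dots> = (\<Sum>i=1..n. f (?m (Suc i)) - f (?m i))"
    by (subst sum_Suc_diff) (use blk_in[of undefined] in auto)
  also have "\<dots> \<le> (\<Sum>i=1..n. - (P i (v k) \<bullet> ?d i) - ((\<gamma> - 1) * Lm) * (norm (?d i))\<^sup>2)"
    by (intro sum_mono block)
  also have "\<dots> = - (v k \<bullet> (z (Suc k) - z k)) - ((\<gamma> - 1) * Lm) * (norm (z (Suc k) - z k))\<^sup>2"
    by (simp only: sum_subtractf sum_negf sum_distrib_left[symmetric] power2_norm_eq_inner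
        inner_eq_sum_blocks[OF blocks, of "v k"] inner_eq_sum_blocks[OF blocks, of "z (Suc k) - z k"])
  finally show ?thesis by simp
qed

theorem palm_converges:
  assumes loj: "\<And>zb. stationary (objective blk n p h f) zb \<Longrightarrow> lojasiewicz_at (objective blk n p h f) zb"
    and theta: "\<theta>b \<in> {0<..<1}"
    and tail: "summable (\<lambda>k. (\<Sum>t. (\<epsilon> (k + t))\<^sup>2) powr \<theta>b)"
  shows "\<exists>zs. z \<longlonglongrightarrow> zs \<and> stationary (objective blk n p h f) zs"
proof -
  have F: "objective blk n p h f = constrained f S" unfolding S_def by (rule objective_eq)
  obtain K where K: "\<And>k. K \<le> k \<Longrightarrow> z (Suc k) \<in> B"
    using eventually_in_B unfolding eventually_sequentially by blast
  obtain c1 where c1: "0 \<le> c1" "\<And>k. z (Suc k) \<in> B \<Longrightarrow> infdist (z (Suc k)) S \<le> c1 * (\<epsilon> k)\<^sup>2"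
    by (rule iterate_near_S) blast
  obtain c2 where c2: "0 \<le> c2" "\<And>k y. y \<in> S \<Longrightarrow> (y - z (Suc k)) \<bullet> v k \<le> c2 * (\<epsilon> k)\<^sup>2"
    by (rule approx_optimality) blast
  define c3 where "c3 = real n * (M + Lm)"
  have c3: "0 \<le> c3"
    unfolding c3_def using Lm_pos sigma_pos[OF blk_in[of undefined], of 0] sigma(2)[OF blk_in[of undefined], of 0]
    by (intro mult_nonneg_nonneg) auto
  define C where "C = c1 + c2 + c3"
  have C: "c1 \<le> C" "c2 \<le> C" "c3 \<le> C" "0 \<le> C" using c1(1) c2(1) c3 by (auto simp: C_def)
  \<comment> \<open>\<open>Z j\<close> is produced with tolerance \<open>\<epsilon> (K + j)\<close>, and the step from it to \<open>Z (Suc j)\<close> has index \<open>Suc (K + j)\<close>\<close>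
  define Z where "Z j = z (Suc (K + j))" for j
  have ZB: "Z j \<in> B" for j unfolding Z_def by (rule K) simp
  interpret inexact_descent f G S B Z "\<lambda>j. v (Suc (K + j))" "\<lambda>j. \<epsilon> (K + j)"
    "real n * Lm" "(\<gamma> - 1) * Lm" C
  proof
    show "infdist (Z k) S \<le> C * (\<epsilon> (K + k))\<^sup>2" for k
      unfolding Z_def by (rule order_trans[OF c1(2)[OF K]]) (auto intro: mult_right_mono C)
    show "(y - Z (Suc k)) \<bullet> v (Suc (K + k)) \<le> C * (\<epsilon> (K + Suc k))\<^sup>2" if "y \<in> S" for k y
      using c2(2)[OF that, of "Suc (K + k)"] mult_right_mono[OF C(2), of "(\<epsilon> (Suc (K + k)))\<^sup>2"]
      by (simp add: Z_def)
    show "norm (v (Suc (K + k)) + G (Z (Suc k))) \<le> C * norm (Z (Suc k) - Z k)" for k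
      using residual_gradient[of "Suc (K + k)"] ZB[of k] ZB[of "Suc k"]
        mult_right_mono[OF C(3), of "norm (Z (Suc k) - Z k)"]
      by (simp add: Z_def c3_def)
    show "f (Z (Suc k)) \<le> f (Z k) - v (Suc (K + k)) \<bullet> (Z (Suc k) - Z k)
        - (\<gamma> - 1) * Lm * (norm (Z (Suc k) - Z k))\<^sup>2" for k
      using sweep_descent[of "Suc (K + k)"] ZB[of k] ZB[of "Suc k"] by (simp add: Z_def)
    show "summable (\<lambda>j. \<epsilon> (K + j))"
      using eps_summable summable_iff_shift[of \<epsilon> K] by (simp add: add.commute)
  qed (use S_props G G_lipschitz ZB Lm_pos gamma C eps_nonneg in auto)
  have "\<exists>zs. Z \<longlonglongrightarrow> zs \<and> stationary (constrained f S) zs"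
  proof (rule converges_to_stationary)
    have "summable (\<lambda>k. (\<Sum>t. (\<epsilon> ((k + K) + t))\<^sup>2) powr \<theta>b)"
      using tail summable_iff_shift[of "\<lambda>k. (\<Sum>t. (\<epsilon> (k + t))\<^sup>2) powr \<theta>b" K] by simp
    then show "summable (\<lambda>k. E k powr \<theta>b)" unfolding E_def by (simp add: add_ac)
  qed (use loj theta F in auto)
  then obtain zs where zs: "Z \<longlonglongrightarrow> zs" "stationary (constrained f S) zs" by blast
  have "(\<lambda>j. z (j + Suc K)) \<longlonglongrightarrow> zs" using zs(1) by (simp add: Z_def[abs_def] add.commute)
  then have "z \<longlonglongrightarrow> zs" by (rule LIMSEQ_offset)
  then show ?thesis using zs(2) F by auto
qed

end

theorem theorem4p1:
  fixes blk :: "'d::finite \<Rightarrow> nat" and n :: nat and p :: "nat \<Rightarrow> nat"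
    and f :: "real^'d \<Rightarrow> real" and h :: "nat \<Rightarrow> nat \<Rightarrow> real^'d \<Rightarrow> real"
    and z :: "nat \<Rightarrow> real^'d" and \<sigma> :: "nat \<Rightarrow> nat \<Rightarrow> real"
    and \<epsilon> :: "nat \<Rightarrow> real" and eb \<gamma> M \<theta>b :: real and L :: "nat \<Rightarrow> real"
  assumes blocks: "range blk = {1..n}"
    and p_pos: "\<And>i. i \<in> {1..n} \<Longrightarrow> p i \<ge> 1"
    and f_diff: "f differentiable_on UNIV"
    and h_convex: "\<And>i j. i \<in> {1..n} \<Longrightarrow> j \<in> {1..p i} \<Longrightarrow> convex_on (bspace blk i) (h i j)"
    and h_diff: "\<And>i j. i \<in> {1..n} \<Longrightarrow> j \<in> {1..p i} \<Longrightarrow> h i j differentiable_on bspace blk i"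
    and gamma: "\<gamma> > 1"
    and run: "palm_I blk n p h f eb \<epsilon> (\<gamma> * Max (L ` {1..n})) M \<sigma> z"
    and L_pos: "\<And>i. i \<in> {1..n} \<Longrightarrow> L i > 0"
    and lipschitz: "\<And>i z1 z2. i \<in> {1..n} \<Longrightarrow> z1 \<in> bprod blk n (feas_bar blk p h eb) \<Longrightarrow>
          z2 \<in> bprod blk n (feas_bar blk p h eb) \<Longrightarrow>
          norm (pgrad blk f i z1 - pgrad blk f i z2) \<le> L i * norm (z1 - z2)"
    and S_convex: "\<And>i. i \<in> {1..n} \<Longrightarrow> convex (feas blk p h i)"
    and S_compact: "\<And>i. i \<in> {1..n} \<Longrightarrow> compact (feas blk p h i)"
    and cq: "\<And>i. i \<in> {1..n} \<Longrightarrow> linear_constr blk p h i \<or> slater blk p h i"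
    and error_bound: "\<And>i. i \<in> {1..n} \<Longrightarrow> \<exists>c\<ge>0.
          \<forall>w\<in>feas_tilde blk n p h f eb (\<gamma> * Max (L ` {1..n})) i.
            edist_set w (feas blk p h i) \<le> ereal (c * L2_set (\<lambda>j. max (h i j w) 0) {1..p i})"
    and lojasiewicz: "\<And>zb. stationary (objective blk n p h f) zb \<Longrightarrow>
          lojasiewicz_at (objective blk n p h f) zb"
    and eps_summable: "summable \<epsilon>"
    and theta: "\<theta>b \<in> {0<..<1}"
    and tail_summable: "summable (\<lambda>k. (\<Sum>t. (\<epsilon> (k + t))\<^sup>2) powr \<theta>b)"
  shows "\<exists>zs. z \<longlonglongrightarrow> zs \<and> stationary (objective blk n p h f) zs"
proof -
  interpret palm_setting blk n p f h z \<sigma> \<epsilon> eb \<gamma> M L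
    by (unfold_locales; (rule assms | (rule assms; assumption)))
  show ?thesis by (rule palm_converges[OF lojasiewicz theta tail_summable])
qed

end
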